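(* For all integers $d\ge 3$ and $0\le k\le d-1$ with $(d,k)\ne(3,1)$, there exists a $d$-polytope that is not weakly $k$-scribable.
   Context: Let $\mathbb S^d=\{x\in\mathbb R^{d+1}:\|x\|_2=1\}$, with coordinates $x_0,\dots,x_d$. A spherical polytope is an intersection of finitely many closed hemispheres of $\mathbb S^d$ containing no two antipodal points; equivalently, $\mathcal P=\mathcal K\cap\mathbb S^d$ for a pointed polyhedral cone $\mathcal K\subset\mathbb R^{d+1}$. Its $k$-faces are the intersections with $\mathbb S^d$ of the $(k+1)$-dimensional faces of $\mathcal K$. A $d$-polytope is a polytope of dimension $d$. Every Euclidean $d$-polytope has the same face lattice as some spherical $d$-polytope and conversely. A realization of a combinatorial type of $d$-polytope is a spherical $d$-polytope in $\mathbb S^d$ with isomorphic face lattice. Let $\mathcal B=\{x\in\mathbb S^d: x_0\ge 0,\ -x_0^2+x_1^2+\dots+x_d^2\le 0\}$ (a spherical cap) and let $\mathcal S=\partial\mathcal B$ be its boundary sphere. For a face $F$, $\operatorname{Span}(F)$ denotes its spherical span, i.e. the intersection of the linear span of $F$ with $\mathbb S^d$ (so the span of a vertex $v$ is $\{v,-v\}$). A face $F$ is weakly tangent to $\mathcal S$ if $\operatorname{Span}(F)\cap\mathcal S$ consists of a single point and $\operatorname{Span}(F)$ is tangent to $\mathcal S$ there (i.e. $\operatorname{Span}(F)$ does not meet the interior of $\mathcal B$). A spherical polytope is weakly $k$-scribed if all its $k$-faces are weakly tangent to $\mathcal S$. A combinatorial type of $d$-polytope is weakly $k$-scribable if it has a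 weakly $k$-scribed realization as a spherical polytope. *)

theory Defs
  imports "HOL-Analysis.Analysis"
begin

section \<open>Spherical polytopes\<close>

definition closed_hemisphere :: "'a::euclidean_space \<Rightarrow> 'a set" where
  "closed_hemisphere a = {x \<in> sphere 0 1. 0 \<le> a \<bullet> x}"

definition spherical_polytope :: "'a::euclidean_space set \<Rightarrow> bool" where
  "spherical_polytope P \<longleftrightarrow>
     (\<exists>A. finite A \<and> 0 \<notin> A \<and> P = sphere 0 1 \<inter> (\<Inter>a\<in>A. closed_hemisphere a)) \<and>
     (\<forall>x\<in>P. - x \<notin> P)"

text \<open>The pointed polyhedral cone \<open>K\<close> with \<open>P = K \<inter> sphere 0 1\<close>.
  The origin is added because \<open>conic hull {} = {}\<close>.\<close>

definition cone_over :: "'a::euclidean_space set \<Rightarrow> 'a set" where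
  "cone_over P = insert 0 (conic hull P)"

lemma cone_over_hemispheres:
  fixes A :: "'a::euclidean_space set"
  shows "cone_over (sphere 0 1 \<inter> (\<Inter>a\<in>A. closed_hemisphere a)) = {x. \<forall>a\<in>A. 0 \<le> a \<bullet> x}"
proof (intro equalityI subsetI)
  fix x assume "x \<in> cone_over (sphere 0 1 \<inter> (\<Inter>a\<in>A. closed_hemisphere a))"
  then show "x \<in> {x. \<forall>a\<in>A. 0 \<le> a \<bullet> x}"
    by (auto simp: cone_over_def conic_hull_explicit closed_hemisphere_def)
next
  fix x :: 'a assume x: "x \<in> {x. \<forall>a\<in>A. 0 \<le> a \<bullet> x}"
  show "x \<in> cone_over (sphere 0 1 \<inter> (\<Inter>a\<in>A. closed_hemisphere a))"
  proof (cases "x = 0")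
    case False
    let ?u = "x /\<^sub>R norm x"
    have "?u \<in> sphere 0 1 \<inter> (\<Inter>a\<in>A. closed_hemisphere a)"
      using x False by (auto simp: closed_hemisphere_def)
    moreover have "x = norm x *\<^sub>R ?u"
      using False by simp
    ultimately show ?thesis
      unfolding cone_over_def conic_hull_explicit
      by (smt (verit) insertCI mem_Collect_eq norm_ge_zero)
  qed (simp add: cone_over_def)
qed

definition spherical_dim :: "'a::euclidean_space set \<Rightarrow> int" where
  "spherical_dim P = aff_dim (cone_over P) - 1"

definition spherical_d_polytope :: "nat \<Rightarrow> 'a::euclidean_space set \<Rightarrow> bool" where
  "spherical_d_polytope d P \<longleftrightarrow> spherical_polytope P \<and> spherical_dim P = int d"

definition spherical_k_face :: "nat \<Rightarrow> 'a::euclidean_space set \<Rightarrow> 'a set \<Rightarrow> bool" where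
  "spherical_k_face k P F \<longleftrightarrow>
     (\<exists>G. G face_of cone_over P \<and> aff_dim G = int (k + 1) \<and> F = G \<inter> sphere 0 1)"

text \<open>The face lattice, with the improper faces \<open>{}\<close> and \<open>P\<close>. Both
  \<open>{}\<close> and \<open>{0}\<close> are faces of the cone; both give the empty face of \<open>P\<close>.\<close>

definition spherical_faces :: "'a::euclidean_space set \<Rightarrow> 'a set set" where
  "spherical_faces P = {G \<inter> sphere 0 1 | G. G face_of cone_over P}"

definition combinatorially_equivalent ::
    "'a::euclidean_space set \<Rightarrow> 'b::euclidean_space set \<Rightarrow> bool" where
  "combinatorially_equivalent P Q \<longleftrightarrow>
     (\<exists>f. bij_betw f (spherical_faces P) (spherical_faces Q) \<and>
          (\<forall>F\<in>spherical_faces P. \<forall>G\<in>spherical_faces P. F \<subseteq> G \<longleftrightarrow> f F \<subseteq> f G))"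

definition spherical_span :: "'a::euclidean_space set \<Rightarrow> 'a set" where
  "spherical_span F = span F \<inter> sphere 0 1"


section \<open>Weak scribability\<close>

text \<open>The ambient space \<open>\<real>\<^bsup>d+1\<^esup>\<close> is \<^typ>\<open>real \<times> (real^'n)\<close> with \<open>d = CARD('n)\<close>:
  \<open>fst x\<close> is the coordinate \<open>x\<^sub>0\<close>, and \<open>snd x\<close> has the coordinates
  \<open>x\<^sub>1, \<dots>, x\<^sub>d\<close>. Boundary and interior of the cap are taken in the unit sphere.\<close>

definition cap :: "(real \<times> (real^'n::finite)) set" where
  "cap = {x \<in> sphere 0 1. 0 \<le> fst x \<and> - (fst x)\<^sup>2 + (\<Sum>i\<in>UNIV. (snd x $ i)\<^sup>2) \<le> 0}"

definition cap_sphere :: "(real \<times> (real^'n::finite)) set" where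
  "cap_sphere = top_of_set (sphere 0 1) frontier_of cap"

definition cap_interior :: "(real \<times> (real^'n::finite)) set" where
  "cap_interior = top_of_set (sphere 0 1) interior_of cap"

definition weakly_tangent :: "(real \<times> (real^'n::finite)) set \<Rightarrow> bool" where
  "weakly_tangent F \<longleftrightarrow>
     (\<exists>p. spherical_span F \<inter> cap_sphere = {p}) \<and> spherical_span F \<inter> cap_interior = {}"

definition weakly_scribed :: "nat \<Rightarrow> (real \<times> (real^'n::finite)) set \<Rightarrow> bool" where
  "weakly_scribed k P \<longleftrightarrow> (\<forall>F. spherical_k_face k P F \<longrightarrow> weakly_tangent F)"

text \<open>\<open>P\<close> stands for its combinatorial type; a realization is a full-dimensional
  spherical polytope in the sphere of dimension \<open>CARD('n)\<close>.\<close>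

definition weakly_scribable :: "nat \<Rightarrow> (real \<times> (real^'n::finite)) set \<Rightarrow> bool" where
  "weakly_scribable k P \<longleftrightarrow>
     (\<exists>Q :: (real \<times> (real^'n)) set. spherical_d_polytope CARD('n) Q \<and>
        combinatorially_equivalent P Q \<and> weakly_scribed k Q)"

end

theory Submission
  imports Defs
begin

text \<open>
  A face is weakly tangent iff the Lorentz form is positive semidefinite on its linear span with a
  null vector in the radical. A combinatorial equivalence preserves dimensions of faces, hence
  incidences between vertices and faces can be carried over to any realization.

  For \<open>k = 0\<close> take a cube, one of whose facets is broken into two triangles along a diagonal, and
  form iterated pyramids. If all vertices are null vectors, then by Miquel's theorem the four
  corners of the broken facet are coplanar, a contradiction.
  For \<open>k \<ge> 2\<close> take iterated pyramids over the dual polytope. The null vectors in the \<open>k\<close>-faces of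
  a suitable \<open>(k + 1)\<close>-face that contain a common \<open>(k - 3)\<close>-face are Lorentz orthogonal to that
  face, so they live in a space of dimension 4, and they satisfy the same forbidden incidences.
  For \<open>k = 1\<close> and \<open>d \<ge> 4\<close> take \<open>d + 2\<close> vertices that are pairwise joined by edges. After
  normalization their Lorentz Gram matrix has diagonal entries \<open>1\<close> and all other entries
  \<open>-1\<close>; it is invertible, so the vertices would be linearly independent.
\<close>

section \<open>The face lattice of a spherical polytope\<close>

text \<open>Miquel's theorem in this form: if eight null vectors sit at the corners of a
  combinatorial cube and five of its facets are flat, then so is the sixth. Breaking that facet
  makes the incidences contradictory, and pyramids carry the configuration into higher dimensions
  without changing it. For \<open>k \<ge> 2\<close> the roles are exchanged: the null vectors of the
  tangent faces are the points, and pairing with the vertices of the realization gives the planes.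
  The obstacle is that the form might degenerate on the span of the \<open>(k + 1)\<close>-face, so
  that a null vector would be orthogonal to all vertices. This cannot happen: the spans of the
  facets of a face have no common nonzero vector, while each of these facets carries a null vector
  of its own. For \<open>k = 1\<close> the complete graph comes from a direct sum of two simplices
  with at least three vertices each. A triangle and a simplex of dimension \<open>d - 2\<close>
  qualify as soon as \<open>d \<ge> 4\<close>; in dimension 3 only the tetrahedron has a complete
  graph.\<close>

lemma spherical_polytopeE:
  assumes "spherical_polytope P"
  obtains A where "finite A" "0 \<notin> A" "cone_over P = {x. \<forall>a\<in>A. 0 \<le> a \<bullet> x}"
    "P = cone_over P \<inter> sphere 0 1"
proof -
  obtain A where A: "finite A" "0 \<notin> A" "P = sphere 0 1 \<inter> (\<Inter>a\<in>A. closed_hemisphere a)"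
    using assms unfolding spherical_polytope_def by blast
  have c: "cone_over P = {x. \<forall>a\<in>A. 0 \<le> a \<bullet> x}"
    using A(3) cone_over_hemispheres by blast
  show thesis
  proof (rule that[OF A(1,2) c])
    show "P = cone_over P \<inter> sphere 0 1"
      unfolding c by (subst A(3)) (auto simp: closed_hemisphere_def)
  qed
qed

lemma polyhedron_cone_over: "spherical_polytope P \<Longrightarrow> polyhedron (cone_over P)"
proof -
  assume "spherical_polytope P"
  then obtain A where A: "finite A" "cone_over P = {x. \<forall>a\<in>A. 0 \<le> a \<bullet> x}"
    by (rule spherical_polytopeE)
  have "{x. \<forall>a\<in>A. 0 \<le> a \<bullet> x} = \<Inter> ((\<lambda>a. {x. a \<bullet> x \<ge> 0}) ` A)"
    by auto
  then show ?thesis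
    unfolding A using A(1) by (auto intro!: polyhedron_Inter polyhedron_halfspace_ge)
qed

lemma convex_cone_over: "spherical_polytope P \<Longrightarrow> convex (cone_over P)"
  by (simp add: polyhedron_cone_over polyhedron_imp_convex)

lemma conic_cone_over: "conic (cone_over P)"
  by (metis cone_over_def conic_conic_hull conic_contains_0 conic_hull_0 conic_hull_eq_empty
      insert_absorb insert_not_empty)

lemma zero_in_cone_over: "0 \<in> cone_over P"
  by (simp add: cone_over_def)

lemma cone_over_pointed:
  assumes "spherical_polytope P" "x \<in> cone_over P" "- x \<in> cone_over P"
  shows "x = 0"
proof (rule ccontr)
  assume "x \<noteq> 0"
  obtain A where A: "P = cone_over P \<inter> sphere 0 1"
    using assms(1) by (rule spherical_polytopeE)
  have "(1 / norm x) *\<^sub>R x \<in> cone_over P" "(1 / norm x) *\<^sub>R (- x) \<in> cone_over P"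
    using assms(2,3) by (auto intro!: conicD[OF conic_cone_over] simp del: scaleR_minus_right)
  then have "(1 / norm x) *\<^sub>R x \<in> P" "- ((1 / norm x) *\<^sub>R x) \<in> P"
    using \<open>x \<noteq> 0\<close> by (subst A; simp)+
  then show False
    using assms(1) by (auto simp: spherical_polytope_def)
qed

lemma zero_face_of_cone_over:
  assumes "spherical_polytope P"
  shows "{0} face_of cone_over P"
proof -
  have "0 extreme_point_of cone_over P"
    unfolding extreme_point_of_def
  proof (intro conjI ballI zero_in_cone_over notI)
    fix a b assume ab: "a \<in> cone_over P" "b \<in> cone_over P" "0 \<in> open_segment a b"
    then obtain u where u: "a \<noteq> b" "0 < u" "u < 1" "0 = (1 - u) *\<^sub>R a + u *\<^sub>R b"
      by (auto simp: in_segment)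
    have eq: "- a = (u / (1 - u)) *\<^sub>R b"
    proof -
      have "(1 - u) *\<^sub>R (- a) = u *\<^sub>R b" using u(4) by (simp add: add_eq_0_iff)
      then have "(1 / (1-u)) *\<^sub>R ((1 - u) *\<^sub>R (- a)) = (1 / (1-u)) *\<^sub>R (u *\<^sub>R b)" by simp
      with u show ?thesis by simp
    qed
    have "- a \<in> cone_over P"
      unfolding eq using u ab by (intro conicD[OF conic_cone_over]) auto
    then have "a = 0" using cone_over_pointed[OF assms ab(1)] by simp
    with eq u show False by auto
  qed
  then show ?thesis by (simp add: face_of_singleton)
qed

lemma span_conic_Int_sphere:
  fixes G :: "'a::real_normed_vector set"
  assumes "conic G"
  shows "span (G \<inter> sphere 0 1) = span G"
proof (rule antisym)
  show "span G \<subseteq> span (G \<inter> sphere 0 1)"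
  proof (rule span_minimal[OF subsetI subspace_span])
    fix x assume x: "x \<in> G"
    show "x \<in> span (G \<inter> sphere 0 1)"
    proof (cases "x = 0")
      case False
      have "x /\<^sub>R norm x \<in> G \<inter> sphere 0 1"
        using conicD[OF assms x, of "inverse (norm x)"] False by auto
      then have "norm x *\<^sub>R (x /\<^sub>R norm x) \<in> span (G \<inter> sphere 0 1)"
        by (intro span_mul span_base)
      with False show ?thesis by simp
    qed (simp add: span_zero)
  qed
qed (simp add: span_mono)

text \<open>The empty face comes from both \<open>{}\<close> and \<open>{0}\<close>, of affine
  dimensions -1 and 0. Choosing \<open>{0}\<close> makes \<open>aff_dim G = int (dim X)\<close> hold
  without exception, so the linear dimension \<open>dim X\<close>, one more than the spherical
  dimension, can be used throughout.\<close>

lemma spherical_facesE: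
  assumes "spherical_polytope P" "X \<in> spherical_faces P"
  obtains G where "G face_of cone_over P" "0 \<in> G" "conic G" "X = G \<inter> sphere 0 1"
    "aff_dim G = int (dim X)" "span G = span X"
proof -
  obtain G0 where G0: "G0 face_of cone_over P" "X = G0 \<inter> sphere 0 1"
    using assms(2) by (auto simp: spherical_faces_def)
  define G where "G = (if G0 = {} then {0} else G0)"
  have G: "G face_of cone_over P" "X = G \<inter> sphere 0 1" "G \<noteq> {}"
    using G0 zero_face_of_cone_over[OF assms(1)] by (auto simp: G_def)
  have c: "conic G" using face_of_conic[OF conic_cone_over G(1)] .
  have z: "0 \<in> G" using c G(3) conic_contains_0 by blast
  have s: "span G = span X"
    using span_conic_Int_sphere[OF c] G(2) by simp
  have "aff_dim G = int (dim G)" using z by (simp add: aff_dim_zero hull_inc)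
  also have "dim G = dim X" using s by (metis dim_span)
  finally show thesis using that G c z s by blast
qed

text \<open>A face of a convex set is cut out by its own affine hull, which here is a linear span
  because the cone face contains 0. This is what makes dimension strictly monotone on faces and lets
  linear dependence be turned into incidence.\<close>

lemma spherical_face_eq_span_Int:
  assumes "spherical_polytope P" "X \<in> spherical_faces P"
  shows "X = span X \<inter> P"
proof -
  obtain G where G: "G face_of cone_over P" "0 \<in> G" "X = G \<inter> sphere 0 1" "span G = span X"
    using assms by (rule spherical_facesE)
  have "G = affine hull G \<inter> cone_over P"
    using face_of_imp_eq_affine_Int[OF convex_cone_over G(1)] assms(1) by blast
  also have "affine hull G = span X"
    using G by (simp add: affine_hull_span_0 hull_inc)
  finally show ?thesis
    using G(3) spherical_polytopeE[OF assms(1)] by (metis Int_assoc)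
qed

lemma spherical_face_subset: 
  "spherical_polytope P \<Longrightarrow> X \<in> spherical_faces P \<Longrightarrow> X \<subseteq> P"
  using spherical_face_eq_span_Int by blast

lemma dim_spherical_face_less:
  assumes "spherical_polytope P" "X \<in> spherical_faces P" "Y \<in> spherical_faces P" "X \<subset> Y"
  shows "dim X < dim Y"
proof -
  have "span X \<noteq> span Y"
    using assms spherical_face_eq_span_Int[OF assms(1)] by blast
  then show ?thesis
    by (metis assms(4) dim_psubset psubsetE psubsetI span_mono)
qed

lemma spherical_facet_exists:
  assumes "spherical_polytope P" "X \<in> spherical_faces P" "dim X > 0"
  obtains Y where "Y \<in> spherical_faces P" "Y \<subset> X" "dim X = Suc (dim Y)"
proof -
  obtain G where G: "G face_of cone_over P" "0 \<in> G" "X = G \<inter> sphere 0 1"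
      "aff_dim G = int (dim X)" "span G = span X"
    using assms(1,2) by (rule spherical_facesE)
  have "{0} face_of G"
    using zero_face_of_cone_over[OF assms(1)] G(1,2) face_of_face[of G "cone_over P" "{0}"] by auto
  moreover have "{0} \<noteq> G" using G(4) assms(3) aff_dim_sing by (metis of_nat_0_less_iff less_irrefl)
  moreover have "polyhedron G"
    using G(1) assms(1) face_of_polyhedron_polyhedron polyhedron_cone_over by blast
  ultimately obtain F where F: "F facet_of G" "{0} \<subseteq> F"
    by (metis face_of_polyhedron_subset_facet insert_not_empty)
  have FK: "F face_of cone_over P" using F G(1) facet_of_imp_face_of face_of_trans by blast
  define Y where "Y = F \<inter> sphere 0 1"
  have Y: "Y \<in> spherical_faces P" using FK by (auto simp: Y_def spherical_faces_def)
  have "Y \<subseteq> X" using F G(3) facet_of_imp_subset by (auto simp: Y_def)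
  have cF: "conic F" using face_of_conic[OF conic_cone_over FK] .
  have "dim F = dim Y"
    by (metis Y_def cF dim_span span_conic_Int_sphere)
  moreover have "aff_dim F = int (dim F)" using F(2) by (simp add: aff_dim_zero hull_inc)
  ultimately have "dim X = Suc (dim Y)"
    using F(1) G(4) by (simp add: facet_of_def)
  then show thesis using that Y \<open>Y \<subseteq> X\<close> by (metis n_not_Suc_n psubsetI)
qed

lemma spherical_k_face_iff:
  assumes "spherical_polytope P"
  shows "spherical_k_face k P X \<longleftrightarrow> X \<in> spherical_faces P \<and> dim X = Suc k"
proof
  assume "spherical_k_face k P X"
  then obtain G where G: "G face_of cone_over P" "aff_dim G = int (k + 1)" "X = G \<inter> sphere 0 1"
    by (auto simp: spherical_k_face_def)
  have X: "X \<in> spherical_faces P" using G by (auto simp: spherical_faces_def)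
  have c: "conic G" using face_of_conic[OF conic_cone_over G(1)] .
  have z: "0 \<in> G" using c G(2) conic_contains_0 by fastforce
  have "dim G = dim X"
    by (metis G(3) c dim_span span_conic_Int_sphere)
  then show "X \<in> spherical_faces P \<and> dim X = Suc k"
    using G(2) z X by (simp add: aff_dim_zero hull_inc)
next
  assume "X \<in> spherical_faces P \<and> dim X = Suc k"
  then show "spherical_k_face k P X"
    using assms spherical_facesE[of P X] unfolding spherical_k_face_def
    by (metis Suc_eq_plus1)
qed

lemma spherical_face_exposed:
  assumes "spherical_polytope P" "X \<in> spherical_faces P"
  obtains a where "\<And>v. v \<in> P \<Longrightarrow> v \<in> X \<longleftrightarrow> a \<bullet> v = 0"
proof -
  obtain G where G: "G face_of cone_over P" "0 \<in> G" "X = G \<inter> sphere 0 1"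
    using assms(1,2) by (rule spherical_facesE)
  have "G exposed_face_of cone_over P"
    using exposed_face_of_polyhedron[OF polyhedron_cone_over[OF assms(1)]] G(1) by blast
  then obtain a b where ab: "G = cone_over P \<inter> {x. a \<bullet> x = b}"
    by (auto simp: exposed_face_of_def)
  have "b = 0" using G(2) ab by auto
  moreover have "P = cone_over P \<inter> sphere 0 1" by (rule spherical_polytopeE[OF assms(1)])
  ultimately show thesis using that[of a] ab G(3) by blast
qed

text \<open>A vector in the linear span of every facet could be added to every point of the cone
  without violating a facet inequality.\<close>

lemma span_facets_avoid:
  assumes "spherical_polytope P" "X \<in> spherical_faces P" "r \<in> span X" "r \<noteq> 0"
  obtains Y where "Y \<in> spherical_faces P" "Y \<subset> X" "dim X = Suc (dim Y)" "r \<notin> span Y"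
proof -
  obtain G where G: "G face_of cone_over P" "0 \<in> G" "conic G" "X = G \<inter> sphere 0 1"
      "aff_dim G = int (dim X)" "span G = span X"
    using assms(1,2) by (rule spherical_facesE)
  have "polyhedron G"
    using G(1) assms(1) face_of_polyhedron_polyhedron polyhedron_cone_over by blast
  then obtain F where F: "finite F" "G = (affine hull G) \<inter> \<Inter>F"
    "\<forall>h \<in> F. \<exists>a b. a \<noteq> 0 \<and> h = {x. a \<bullet> x \<le> b}"
    "\<And>F'. F' \<subset> F \<Longrightarrow> G \<subset> (affine hull G) \<inter> \<Inter>F'"
    using polyhedron_Int_affine_minimal[of G] by blast
  from F(3) obtain a b where ab: "\<And>h. h \<in> F \<Longrightarrow> a h \<noteq> 0 \<and> h = {x. a h \<bullet> x \<le> b h}"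
    by metis
  have aff: "affine hull G = span X"
    using G by (simp add: affine_hull_span_0 hull_inc)
  have "\<exists>h\<in>F. a h \<bullet> r \<noteq> 0 \<or> b h \<noteq> 0"
  proof (rule ccontr)
    assume "\<not> ?thesis"
    then have "r \<in> h \<and> - r \<in> h" if "h \<in> F" for h
      using that by (subst (1 2) conjunct2[OF ab[OF that]]) auto
    then have "r \<in> \<Inter>F" "- r \<in> \<Inter>F" by auto
    then have "r \<in> G" "- r \<in> G"
      using F(2) aff assms(3) by (auto simp: span_neg)
    then show False
      using cone_over_pointed[OF assms(1)] assms(4) face_of_imp_subset[OF G(1)] by blast
  qed
  then obtain h where h: "h \<in> F" "a h \<bullet> r \<noteq> 0 \<or> b h \<noteq> 0" by blast
  define H where "H = G \<inter> {x. a h \<bullet> x = b h}"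
  have HF: "H facet_of G"
    using facet_of_polyhedron_explicit[OF F(1,2) ab F(4)] h H_def by blast
  then have HK: "H face_of cone_over P" using G(1) facet_of_imp_face_of face_of_trans by blast
  have cH: "conic H" using face_of_conic[OF conic_cone_over HK] .
  have zH: "0 \<in> H" using cH HF conic_contains_0 facet_of_def by blast
  then have b0: "b h = 0" by (auto simp: H_def)
  then have ar: "a h \<bullet> r \<noteq> 0" using h by simp
  define Y where "Y = H \<inter> sphere 0 1"
  have YP: "Y \<in> spherical_faces P" using HK by (auto simp: Y_def spherical_faces_def)
  have sub: "H \<subseteq> {x. a h \<bullet> x = 0}" using b0 by (auto simp: H_def)
  have nr: "r \<notin> span Y"
  proof
    assume "r \<in> span Y"
    moreover have "span Y \<subseteq> {x. a h \<bullet> x = 0}"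
      using sub by (intro span_minimal subspace_hyperplane) (auto simp: Y_def)
    ultimately show False using ar by auto
  qed
  have "aff_dim H = int (dim H)" using zH by (simp add: aff_dim_zero hull_inc)
  then have dH: "dim X = Suc (dim H)" using HF G(5) by (simp add: facet_of_def)
  have dX: "dim X = Suc (dim Y)"
    by (metis Y_def cH dH dim_span span_conic_Int_sphere)
  moreover have "Y \<subseteq> X" using G(4) by (auto simp: Y_def H_def)
  ultimately show thesis using that YP nr by (metis n_not_Suc_n psubsetI)
qed

text \<open>Descend from \<open>X\<close> through facets: each step lowers the dimension by exactly
  1 in \<open>P\<close>, while the images form a strict chain and so lose at least 1 in
  \<open>Q\<close>. Applied to an equivalence and to its inverse, this shows that dimension is a
  combinatorial invariant.\<close>

lemma dim_mono_if_strict_embedding: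
  assumes P: "spherical_polytope P" and Q: "spherical_polytope Q"
    and f: "\<And>X. X \<in> spherical_faces P \<Longrightarrow> f X \<in> spherical_faces Q"
    and mono: "\<And>X Y. X \<in> spherical_faces P \<Longrightarrow> Y \<in> spherical_faces P \<Longrightarrow> X \<subset> Y \<Longrightarrow> f X \<subset> f Y"
    and X: "X \<in> spherical_faces P"
  shows "dim X \<le> dim (f X)"
  using X
proof (induction "dim X" arbitrary: X)
  case (Suc n)
  obtain Y where Y: "Y \<in> spherical_faces P" "Y \<subset> X" "dim X = Suc (dim Y)"
    using spherical_facet_exists[OF P Suc(3)] Suc(2) by (metis zero_less_Suc)
  have "dim (f Y) < dim (f X)"
    using dim_spherical_face_less[OF Q f f mono] Y Suc(3) by blast
  moreover have "dim Y \<le> dim (f Y)" using Suc(1)[of Y] Suc(2) Y by auto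
  ultimately show ?case using Y by simp
next
  case 0
  then show ?case by linarith
qed

lemma combinatorially_equivalentE:
  assumes "combinatorially_equivalent P Q" "spherical_polytope P" "spherical_polytope Q"
  obtains f where "bij_betw f (spherical_faces P) (spherical_faces Q)"
    "\<And>X Y. X \<in> spherical_faces P \<Longrightarrow> Y \<in> spherical_faces P \<Longrightarrow> X \<subseteq> Y \<longleftrightarrow> f X \<subseteq> f Y"
    "\<And>X. X \<in> spherical_faces P \<Longrightarrow> dim (f X) = dim X"
proof -
  obtain f where f: "bij_betw f (spherical_faces P) (spherical_faces Q)"
    "\<And>X Y. X \<in> spherical_faces P \<Longrightarrow> Y \<in> spherical_faces P \<Longrightarrow> X \<subseteq> Y \<longleftrightarrow> f X \<subseteq> f Y"
    using assms(1) by (auto simp: combinatorially_equivalent_def)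
  define g where "g = inv_into (spherical_faces P) f"
  have gf: "g (f X) = X" if "X \<in> spherical_faces P" for X
    using f(1) that by (simp add: g_def bij_betw_inv_into_left)
  have fg: "f (g Y) = Y" "g Y \<in> spherical_faces P" if "Y \<in> spherical_faces Q" for Y
    using f(1) that bij_betw_apply[OF bij_betw_inv_into[OF f(1)] that]
    by (auto simp: g_def bij_betw_inv_into_right)
  have fQ: "f X \<in> spherical_faces Q" if "X \<in> spherical_faces P" for X
    using f(1) that by (rule bij_betw_apply)
  have "dim (f X) = dim X" if X: "X \<in> spherical_faces P" for X
  proof (rule antisym)
    show "dim X \<le> dim (f X)"
    proof (rule dim_mono_if_strict_embedding[OF assms(2,3) fQ _ X])
      show "f Y \<subset> f Z" if "Y \<in> spherical_faces P" "Z \<in> spherical_faces P" "Y \<subset> Z" for Y Z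
        using that(3) f(2)[OF that(1,2)] f(2)[OF that(2,1)] by auto
    qed
    have gmono: "g Y \<subset> g Z" if "Y \<in> spherical_faces Q" "Z \<in> spherical_faces Q" "Y \<subset> Z" for Y Z
      using that(3) f(2)[OF fg(2)[OF that(1)] fg(2)[OF that(2)]]
        f(2)[OF fg(2)[OF that(2)] fg(2)[OF that(1)]] fg(1) that(1,2) by auto
    have "dim (f X) \<le> dim (g (f X))"
      by (rule dim_mono_if_strict_embedding[OF assms(3,2) fg(2) gmono fQ[OF X]])
    then show "dim (f X) \<le> dim X" by (simp add: gf X)
  qed
  with f that show thesis by blast
qed

text \<open>The line spanned by \<open>X\<close> meets the sphere in two antipodal points, and a
  spherical polytope never contains both.\<close>

lemma spherical_face_dim_1:
  assumes "spherical_polytope P" "X \<in> spherical_faces P" "dim X = 1"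
  obtains v where "X = {v}"
proof -
  have "X \<subseteq> sphere 0 1" using assms(2) by (auto simp: spherical_faces_def)
  have "X \<noteq> {}" using assms(3) by auto
  then obtain v where v: "v \<in> X" by blast
  have nv: "norm v = 1" using v \<open>X \<subseteq> sphere 0 1\<close> by auto
  have "w = v" if w: "w \<in> X" for w
  proof -
    have "span {v} = span X"
      by (rule subspace_dim_equal) (use v assms(3) nv in \<open>auto simp: span_mono\<close>)
    then obtain c where c: "w = c *\<^sub>R v" using w span_base[of w X] by (auto simp: span_singleton)
    moreover have "norm w = 1" using w \<open>X \<subseteq> sphere 0 1\<close> by auto
    ultimately have "\<bar>c\<bar> = 1" using nv by simp
    moreover have "w \<noteq> - v"
      using assms(1) w v spherical_face_subset[OF assms(1,2)]
      unfolding spherical_polytope_def by blast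
    ultimately show ?thesis using c by (auto simp: abs_if split: if_splits)
  qed
  then show thesis using that v by blast
qed

text \<open>Faces of linear dimension 1 are singletons, so \<open>f\<close> induces a map
  \<open>g\<close> on vertices. The obstructions below can then be stated by incidences in the
  realization \<open>Q\<close> alone.\<close>

lemma combinatorially_equivalent_verticesE:
  assumes "combinatorially_equivalent P Q" "spherical_polytope P" "spherical_polytope Q"
  obtains f g where "\<And>X. X \<in> spherical_faces P \<Longrightarrow> f X \<in> spherical_faces Q"
    "\<And>X Y. X \<in> spherical_faces P \<Longrightarrow> Y \<in> spherical_faces P \<Longrightarrow> f X \<subseteq> f Y \<longleftrightarrow> X \<subseteq> Y"
    "\<And>X. X \<in> spherical_faces P \<Longrightarrow> dim (f X) = dim X"
    "\<And>p. {p} \<in> spherical_faces P \<Longrightarrow> {g p} \<in> spherical_faces Q"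
    "\<And>p X. {p} \<in> spherical_faces P \<Longrightarrow> X \<in> spherical_faces P \<Longrightarrow> g p \<in> f X \<longleftrightarrow> p \<in> X"
proof -
  obtain f where f: "bij_betw f (spherical_faces P) (spherical_faces Q)"
    "\<And>X Y. X \<in> spherical_faces P \<Longrightarrow> Y \<in> spherical_faces P \<Longrightarrow> X \<subseteq> Y \<longleftrightarrow> f X \<subseteq> f Y"
    "\<And>X. X \<in> spherical_faces P \<Longrightarrow> dim (f X) = dim X"
    using combinatorially_equivalentE[OF assms] by metis
  have fQ: "f X \<in> spherical_faces Q" if "X \<in> spherical_faces P" for X
    using f(1) that by (rule bij_betw_apply)
  have "\<exists>q. f {p} = {q}" if p: "{p} \<in> spherical_faces P" for p
  proof -
    have "norm p = 1" using p by (auto simp: spherical_faces_def)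
    then have "dim {p} = 1" by (subst dim_singleton) auto
    then show ?thesis using spherical_face_dim_1[OF assms(3) fQ[OF p]] f(3)[OF p] by metis
  qed
  then obtain g where g: "\<And>p. {p} \<in> spherical_faces P \<Longrightarrow> f {p} = {g p}" by metis
  show thesis
  proof (rule that[of f g])
    show "{g p} \<in> spherical_faces Q" if "{p} \<in> spherical_faces P" for p
      using fQ[OF that] g[OF that] by simp
    show "g p \<in> f X \<longleftrightarrow> p \<in> X" if "{p} \<in> spherical_faces P" "X \<in> spherical_faces P" for p X
      using f(2)[OF that] g[OF that(1)] by simp
  qed (use f fQ in auto)
qed

section \<open>The Lorentz form and tangent faces\<close>

definition lorentz :: "real \<times> (real^'n) \<Rightarrow> real \<times> (real^'n) \<Rightarrow> real" where
  "lorentz x y = snd x \<bullet> snd y - fst x * fst y"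

lemma bilinear_lorentz: "bilinear lorentz"
  by (auto simp: bilinear_def lorentz_def algebra_simps inner_simps intro!: linearI)

lemmas lorentz_simps = bilinear_ladd[OF bilinear_lorentz] bilinear_radd[OF bilinear_lorentz]
  bilinear_lsub[OF bilinear_lorentz] bilinear_rsub[OF bilinear_lorentz]
  bilinear_lmul[OF bilinear_lorentz] bilinear_rmul[OF bilinear_lorentz]
  bilinear_lneg[OF bilinear_lorentz] bilinear_rneg[OF bilinear_lorentz]
  bilinear_lzero[OF bilinear_lorentz] bilinear_rzero[OF bilinear_lorentz]

lemma linear_lorentz: "linear (lorentz x)" "linear (\<lambda>x. lorentz x y)"
  using bilinear_lorentz unfolding bilinear_def by blast+

lemma lorentz_commute: "lorentz x y = lorentz y x"
  by (simp add: lorentz_def inner_commute mult.commute)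

lemma subspace_lorentz_orthogonal: "subspace {x. lorentz r x = 0}"
  by (auto simp: subspace_def lorentz_simps)

lemma scaleR_eq_imp_eq_divide:
  fixes x y :: "'a::real_vector"
  assumes "c *\<^sub>R x = d *\<^sub>R y" "c \<noteq> 0"
  shows "x = (d / c) *\<^sub>R y"
proof -
  have "x = (1 / c) *\<^sub>R (c *\<^sub>R x)" using assms(2) by simp
  also have "\<dots> = (d / c) *\<^sub>R y" by (simp add: assms(1))
  finally show ?thesis .
qed

lemma span_pairE:
  assumes "x \<in> span {p, q}"
  obtains \<alpha> \<beta> where "x = \<alpha> *\<^sub>R p + \<beta> *\<^sub>R q"
proof -
  obtain \<alpha> where "x - \<alpha> *\<^sub>R p \<in> span {q}" using assms unfolding span_insert[of p] by blast
  then obtain \<beta> where "x - \<alpha> *\<^sub>R p = \<beta> *\<^sub>R q" by (auto simp: span_singleton)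
  then have "x = \<alpha> *\<^sub>R p + \<beta> *\<^sub>R q" by (simp add: algebra_simps)
  then show thesis by (rule that)
qed

text \<open>The form has a single negative direction. Eliminating the coordinate \<open>fst\<close>
  from the two vectors leaves a null vector without that coordinate, where the form is positive
  definite.\<close>

lemma lorentz_isotropic_parallel:
  assumes "lorentz x x = 0" "lorentz y y = 0" "lorentz x y = 0" "x \<noteq> 0"
  obtains c where "y = c *\<^sub>R x"
proof -
  have "fst x \<noteq> 0"
  proof
    assume "fst x = 0"
    with assms(1) have "snd x = 0" by (simp add: lorentz_def)
    with \<open>fst x = 0\<close> assms(4) show False by (simp add: prod_eq_iff)
  qed
  define z where "z = fst x *\<^sub>R y - fst y *\<^sub>R x"
  have "fst z = 0" "lorentz z z = 0"
    using assms by (simp_all add: z_def lorentz_simps lorentz_commute[of y x])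
  then have "z = 0" by (simp add: lorentz_def prod_eq_iff)
  then have "fst x *\<^sub>R y = fst y *\<^sub>R x" by (simp add: z_def)
  then have "y = (fst y / fst x) *\<^sub>R x"
    using scaleR_eq_imp_eq_divide \<open>fst x \<noteq> 0\<close> by blast
  then show thesis by (rule that)
qed

text \<open>Along the line \<open>t *\<^sub>R r + w\<close> the form is affine in \<open>t\<close>
  with slope \<open>2 * lorentz r w\<close>, so it can stay nonnegative only if the slope is
  0.\<close>

lemma psd_null_orthogonal:
  assumes W: "subspace W" and psd: "\<And>w. w \<in> W \<Longrightarrow> 0 \<le> lorentz w w"
    and r: "r \<in> W" "lorentz r r = 0" and w: "w \<in> W"
  shows "lorentz r w = 0"
proof (rule ccontr)
  assume nz: "lorentz r w \<noteq> 0"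
  define t where "t = - (lorentz w w + 1) / (2 * lorentz r w)"
  have "0 \<le> lorentz (t *\<^sub>R r + w) (t *\<^sub>R r + w)"
    by (intro psd subspace_add subspace_mul W r w)
  also have "\<dots> = 2 * t * lorentz r w + lorentz w w"
    by (simp add: lorentz_simps r(2) lorentz_commute[of w r])
  also have "\<dots> = - 1" using nz by (simp add: t_def field_simps)
  finally show False by simp
qed

section \<open>The cap and weak tangency in terms of the Lorentz form\<close>

lemma lorentz_self: "lorentz x x = - (fst x)\<^sup>2 + (\<Sum>i\<in>UNIV. (snd x $ i)\<^sup>2)"
  by (simp add: lorentz_def inner_vec_def power2_eq_square)

lemma cap_eq: "cap = sphere 0 1 \<inter> {x. 0 \<le> fst x \<and> lorentz x x \<le> 0}"
  by (auto simp: cap_def lorentz_self)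

lemma continuous_on_lorentz_self: "continuous_on S (\<lambda>x. lorentz x x)"
  unfolding lorentz_def by (intro continuous_intros)

lemma timelike_in_cap_interior:
  assumes "x \<in> sphere 0 1" "0 < fst x" "lorentz x x < 0"
  shows "x \<in> cap_interior"
proof -
  define T where "T = sphere 0 1 \<inter> ({x. 0 < fst x} \<inter> {x :: real \<times> (real^'a). lorentz x x < 0})"
  have "open ({x. 0 < fst x} \<inter> {x :: real \<times> (real^'a). lorentz x x < 0})"
    by (intro open_Int open_Collect_less continuous_intros continuous_on_lorentz_self)
  then have "openin (top_of_set (sphere 0 1)) T"
    unfolding T_def by (rule openin_open_Int)
  moreover have "T \<subseteq> cap" by (auto simp: T_def cap_eq)
  moreover have "x \<in> T" using assms by (simp add: T_def)
  ultimately show ?thesis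
    unfolding cap_interior_def using interior_of_maximal by blast
qed

lemma cap_sphere_null:
  assumes "x \<in> cap_sphere"
  shows "x \<in> sphere 0 1" "lorentz x x = 0"
proof -
  have "closed {x :: real \<times> (real^'a). 0 \<le> fst x \<and> lorentz x x \<le> 0}"
    unfolding Collect_conj_eq
    by (intro closed_Int closed_Collect_le continuous_intros continuous_on_lorentz_self)
  then have "closedin (top_of_set (sphere 0 1)) (cap :: (real \<times> (real^'a)) set)"
    unfolding cap_eq by (rule closedin_closed_Int)
  then have x: "x \<in> cap" "x \<notin> cap_interior"
    using assms by (auto simp: cap_sphere_def cap_interior_def frontier_of_def closure_of_closedin)
  then show "x \<in> sphere 0 1" by (auto simp: cap_eq)
  show "lorentz x x = 0"
  proof (rule ccontr)
    assume "lorentz x x \<noteq> 0"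
    then have neg: "lorentz x x < 0" using x by (auto simp: cap_eq)
    then have "fst x \<noteq> 0"
      by (metis inner_ge_zero lorentz_def mult_zero_left diff_zero not_le)
    with x neg show False
      using timelike_in_cap_interior[of x] by (auto simp: cap_eq)
  qed
qed

lemma weakly_tangentD:
  assumes "weakly_tangent F"
  obtains r where "r \<in> span F" "r \<noteq> 0" "lorentz r r = 0"
    "\<And>w. w \<in> span F \<Longrightarrow> lorentz r w = 0" "\<And>w. w \<in> span F \<Longrightarrow> 0 \<le> lorentz w w"
proof -
  obtain r where r: "r \<in> spherical_span F" "r \<in> cap_sphere" 
    and d: "spherical_span F \<inter> cap_interior = {}"
    using assms unfolding weakly_tangent_def by blast
  have psd: "0 \<le> lorentz w w" if w: "w \<in> span F" for w
  proof (rule ccontr)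
    assume "\<not> ?thesis"
    then have neg: "lorentz w w < 0" by simp
    then have nz: "fst w \<noteq> 0"
      by (metis inner_ge_zero lorentz_def mult_zero_left diff_zero not_le)
    then have "w \<noteq> 0" by auto
    \<comment> \<open>The span is symmetric, so the sign can be chosen to put the timelike vector on
      the side of the cap rather than of its antipode.\<close>
    define u where "u = (sgn (fst w) / norm w) *\<^sub>R w"
    have "u \<in> span F" unfolding u_def by (intro span_mul w)
    moreover have "norm u = 1" using nz \<open>w \<noteq> 0\<close> by (simp add: u_def abs_sgn_eq)
    moreover have "0 < fst u"
      using nz \<open>w \<noteq> 0\<close> by (auto simp: u_def sgn_if)
    moreover have "lorentz u u < 0"
    proof -
      have "lorentz u u = (sgn (fst w) / norm w)\<^sup>2 * lorentz w w"
        by (simp add: u_def lorentz_simps power2_eq_square)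
      with neg nz \<open>w \<noteq> 0\<close> show ?thesis by (simp add: mult_pos_neg sgn_zero_iff)
    qed
    ultimately have "u \<in> spherical_span F \<inter> cap_interior"
      using timelike_in_cap_interior[of u] by (simp add: spherical_span_def)
    with d show False by blast
  qed
  have rs: "r \<in> span F" "r \<noteq> 0" "lorentz r r = 0"
    using r cap_sphere_null[OF r(2)] by (auto simp: spherical_span_def)
  show thesis
    by (rule that[OF rs psd_null_orthogonal[OF subspace_span psd rs(1,3)] psd])
qed

section \<open>Miquel's theorem\<close>

text \<open>Facets \<open>2n\<close> and \<open>2n + 1\<close> of the cube lie where the \<open>n\<close>-th coordinate is 0 (\<open>False\<close>) and
  1 (\<open>True\<close>). Facet 4 is the broken one, so it misses the origin.\<close>

fun incident :: "nat \<Rightarrow> bool \<times> bool \<times> bool \<Rightarrow> bool" where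
  "incident m (i, j, k) =
    (if m = 0 then \<not> i else if m = 1 then i else if m = 2 then \<not> j else if m = 3 then j
     else if m = 4 then \<not> k \<and> (i \<or> j) else k)"

text \<open>In the basis formed by the corner \<open>P (True, True, True)\<close> and its three neighbours the
  coplanarity relations of five faces turn the null condition for \<open>P (False, False, False)\<close> into
  the coplanarity relation of the sixth.\<close>

lemma miquel:
  fixes P :: "bool \<times> bool \<times> bool \<Rightarrow> real \<times> (real^'n)"
  assumes U: "subspace U" "dim U \<le> 4" and PU: "\<And>p. P p \<in> U"
    and null: "\<And>p. lorentz (P p) (P p) = 0"
    and lin: "\<And>m. m < 6 \<Longrightarrow> linear (h m)"
    and inc: "\<And>m p. m < 6 \<Longrightarrow> h m (P p) = (0::real) \<longleftrightarrow> incident m p"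
  shows False
proof -
  define E0 E1 E2 E3 where E: "E0 = P (True, True, True)" "E1 = P (False, True, True)"
    "E2 = P (True, False, True)" "E3 = P (True, True, False)"
  have l: "linear (h 0)" "linear (h 1)" "linear (h 2)" "linear (h 3)" "linear (h 4)" "linear (h 5)"
    using lin by simp_all
  note ls = l[THEN linear_add] l[THEN linear_cmul] l[THEN linear_0]
  \<comment> \<open>The functionals \<open>h 1\<close>, \<open>h 3\<close>, \<open>h 5\<close> of
    the three facets at the corner \<open>E0\<close> read off the coefficients of \<open>E1\<close>,
    \<open>E2\<close>, \<open>E3\<close>. The opposite ones \<open>h 0\<close>, \<open>h 2\<close>,
    \<open>h 4\<close> do not vanish at \<open>E0\<close> and are normalized there; each kills one
    of \<open>E1\<close>, \<open>E2\<close>, \<open>E3\<close>.\<close>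
  have z1: "h 1 E0 = 0" "h 1 E2 = 0" "h 1 E3 = 0" "h 1 E1 \<noteq> 0"
    and z3: "h 3 E0 = 0" "h 3 E1 = 0" "h 3 E3 = 0" "h 3 E2 \<noteq> 0"
    and z5: "h 5 E0 = 0" "h 5 E1 = 0" "h 5 E2 = 0" "h 5 E3 \<noteq> 0"
    and z0: "h 0 E1 = 0" "h 0 E0 \<noteq> 0" and z2: "h 2 E2 = 0" "h 2 E0 \<noteq> 0"
    and z4: "h 4 E3 = 0" "h 4 E0 \<noteq> 0"
    unfolding E by (simp_all add: inc)
  have "E0 \<noteq> 0" using z0 ls by auto
  have ker: "span S \<subseteq> {x. g x = 0}" if "linear g" "\<And>x. x \<in> S \<Longrightarrow> g x = (0::real)"
    for g :: "_ \<Rightarrow> real" and S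
    using that by (intro span_minimal) (auto simp: linear_subspace_kernel)
  have n1: "E1 \<notin> span {E0}" using ker[OF l(2), of "{E0}"] z1 by auto
  have n2: "E2 \<notin> span {E1, E0}" using ker[OF l(4), of "{E1, E0}"] z3 by auto
  have n3: "E3 \<notin> span {E2, E1, E0}" using ker[OF l(6), of "{E2, E1, E0}"] z5 by auto
  have ind: "independent {E3, E2, E1, E0}"
    using n1 n2 n3 \<open>E0 \<noteq> 0\<close> by (intro independent_insertI independent_empty) auto
  have "E3 \<notin> {E2, E1, E0}" "E2 \<notin> {E1, E0}" "E1 \<notin> {E0}"
    using n1 n2 n3 by (metis span_base)+
  then have "card {E3, E2, E1, E0} = 4" by simp
  then have Us: "U \<subseteq> span {E3, E2, E1, E0}"
    using card_ge_dim_independent[OF _ ind, of U] PU U(2) by (auto simp: E)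
  have ex: "\<exists>s x y z. P p = s *\<^sub>R E0 + x *\<^sub>R E1 + y *\<^sub>R E2 + z *\<^sub>R E3" for p
  proof -
    have "P p \<in> span {E3, E2, E1, E0}" using Us PU by blast
    then obtain z y x s where "P p - z *\<^sub>R E3 - y *\<^sub>R E2 - x *\<^sub>R E1 = s *\<^sub>R E0"
      by (auto simp: span_insert span_singleton)
    then have "P p = s *\<^sub>R E0 + x *\<^sub>R E1 + y *\<^sub>R E2 + z *\<^sub>R E3"
      by (simp add: algebra_simps)
    then show ?thesis by blast
  qed
  have g0: "lorentz E0 E0 = 0" "lorentz E1 E1 = 0" "lorentz E2 E2 = 0" "lorentz E3 E3 = 0"
    by (simp_all add: E null)
  define g01 g02 g03 g12 g13 g23 where g: "g01 = lorentz E0 E1" "g02 = lorentz E0 E2"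
    "g03 = lorentz E0 E3" "g12 = lorentz E1 E2" "g13 = lorentz E1 E3" "g23 = lorentz E2 E3"
  have nullE: "s * x * g01 + s * y * g02 + s * z * g03 + x * y * g12 + x * z * g13 + y * z * g23 = 0"
    if "P p = s *\<^sub>R E0 + x *\<^sub>R E1 + y *\<^sub>R E2 + z *\<^sub>R E3" for p s x y z
    using null[of p] unfolding that g
    by (simp add: lorentz_simps g0 lorentz_commute[of E1 E0] lorentz_commute[of E2 E0]
        lorentz_commute[of E3 E0] lorentz_commute[of E2 E1] lorentz_commute[of E3 E1]
        lorentz_commute[of E3 E2] algebra_simps)
  \<comment> \<open>This factor has to be cancelled in the final identity.\<close>
  have g03: "g03 \<noteq> 0"
  proof
    assume "g03 = 0"
    then obtain c where "E3 = c *\<^sub>R E0"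
      using lorentz_isotropic_parallel[OF g0(1,4) _ \<open>E0 \<noteq> 0\<close>] g by metis
    then show False using z5 ls by simp
  qed
  obtain s3 x3 y3 w3 where p3: "P (False, False, True) = s3 *\<^sub>R E0 + x3 *\<^sub>R E1 + y3 *\<^sub>R E2 + w3 *\<^sub>R E3"
    using ex by blast
  obtain s2 x2 w2 z2 where p2: "P (False, True, False) = s2 *\<^sub>R E0 + x2 *\<^sub>R E1 + w2 *\<^sub>R E2 + z2 *\<^sub>R E3"
    using ex by blast
  obtain s1 w1 y1 z1 where p1: "P (True, False, False) = s1 *\<^sub>R E0 + w1 *\<^sub>R E1 + y1 *\<^sub>R E2 + z1 *\<^sub>R E3"
    using ex by blast
  obtain s x y z where p0: "P (False, False, False) = s *\<^sub>R E0 + x *\<^sub>R E1 + y *\<^sub>R E2 + z *\<^sub>R E3"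
    using ex by blast
  define A2 A3 B1 B3 C1 C2 where ABC: "A2 = h 0 E2 / h 0 E0" "A3 = h 0 E3 / h 0 E0"
    "B1 = h 2 E1 / h 2 E0" "B3 = h 2 E3 / h 2 E0" "C1 = h 4 E1 / h 4 E0" "C2 = h 4 E2 / h 4 E0"
  have h: "h 0 (s *\<^sub>R E0 + x *\<^sub>R E1 + y *\<^sub>R E2 + z *\<^sub>R E3) = h 0 E0 * (s + y * A2 + z * A3)"
    "h 2 (s *\<^sub>R E0 + x *\<^sub>R E1 + y *\<^sub>R E2 + z *\<^sub>R E3) = h 2 E0 * (s + x * B1 + z * B3)"
    "h 4 (s *\<^sub>R E0 + x *\<^sub>R E1 + y *\<^sub>R E2 + z *\<^sub>R E3) = h 4 E0 * (s + x * C1 + y * C2)"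
    "h 1 (s *\<^sub>R E0 + x *\<^sub>R E1 + y *\<^sub>R E2 + z *\<^sub>R E3) = x * h 1 E1"
    "h 3 (s *\<^sub>R E0 + x *\<^sub>R E1 + y *\<^sub>R E2 + z *\<^sub>R E3) = y * h 3 E2"
    "h 5 (s *\<^sub>R E0 + x *\<^sub>R E1 + y *\<^sub>R E2 + z *\<^sub>R E3) = z * h 5 E3" for s x y z
    using z0 z1 z2 z3 z4 z5 by (simp_all add: ls ABC field_simps del: One_nat_def)
  have f3: "w3 = 0" "x3 \<noteq> 0" "y3 \<noteq> 0" "s3 = - y3 * A2" "s3 = - x3 * B1"
    using inc[of 5 "(False, False, True)"] inc[of 1 "(False, False, True)"] inc[of 3 "(False, False, True)"]
      inc[of 0 "(False, False, True)"] inc[of 2 "(False, False, True)"] z0(2) z1(4) z2(2) z3(4) z5(4)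
    unfolding p3 h by (auto simp: add_eq_0_iff2)
  have f2: "w2 = 0" "x2 \<noteq> 0" "z2 \<noteq> 0" "s2 = - z2 * A3" "s2 = - x2 * C1"
    using inc[of 3 "(False, True, False)"] inc[of 1 "(False, True, False)"] inc[of 5 "(False, True, False)"]
      inc[of 0 "(False, True, False)"] inc[of 4 "(False, True, False)"] z0(2) z1(4) z4(2) z3(4) z5(4)
    unfolding p2 h by (auto simp: add_eq_0_iff2)
  have f1: "w1 = 0" "y1 \<noteq> 0" "z1 \<noteq> 0" "s1 = - z1 * B3" "s1 = - y1 * C2"
    using inc[of 1 "(True, False, False)"] inc[of 3 "(True, False, False)"] inc[of 5 "(True, False, False)"]
      inc[of 2 "(True, False, False)"] inc[of 4 "(True, False, False)"] z2(2) z1(4) z4(2) z3(4) z5(4)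
    unfolding p1 h by (auto simp: add_eq_0_iff2)
  have f0: "z \<noteq> 0" "s + y * A2 + z * A3 = 0" "s + x * B1 + z * B3 = 0" "s + x * C1 + y * C2 \<noteq> 0"
    using inc[of 5 "(False, False, False)"] inc[of 0 "(False, False, False)"]
      inc[of 2 "(False, False, False)"] inc[of 4 "(False, False, False)"] z0(2) z2(2) z4(2) z5(4)
    unfolding p0 h by auto
  \<comment> \<open>The corner lies on facets 0 and 2, which gives two expressions for
    \<open>s3\<close>. Using one in each term with \<open>s3\<close> lets \<open>x3 * y3\<close> be
    factored out, and the null condition becomes a formula for \<open>g12\<close>. The other two
    neighbours of the last corner give \<open>g13\<close> and \<open>g23\<close>.\<close>
  have "x3 * y3 * (g12 - A2 * g01 - B1 * g02) = (- y3 * A2) * x3 * g01 + (- x3 * B1) * y3 * g02 + x3 * y3 * g12"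
    by algebra
  also have "\<dots> = 0" using nullE[OF p3] f3 by simp
  finally have g12: "g12 = A2 * g01 + B1 * g02" using f3 by simp
  have "x2 * z2 * (g13 - A3 * g01 - C1 * g03) = (- z2 * A3) * x2 * g01 + (- x2 * C1) * z2 * g03 + x2 * z2 * g13"
    by algebra
  also have "\<dots> = 0" using nullE[OF p2] f2 by simp
  finally have g13: "g13 = A3 * g01 + C1 * g03" using f2 by simp
  have "y1 * z1 * (g23 - B3 * g02 - C2 * g03) = (- z1 * B3) * y1 * g02 + (- y1 * C2) * z1 * g03 + y1 * z1 * g23"
    by algebra
  also have "\<dots> = 0" using nullE[OF p1] f1 by simp
  finally have g23: "g23 = B3 * g02 + C2 * g03" using f1 by simp
  \<comment> \<open>After this substitution the null condition of the last corner splits into the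
    equations of facets 0, 2 and 4. The first two hold, hence so would the third, although the
    corner is off facet 4.\<close>
  have "0 = x * g01 * (s + y * A2 + z * A3) + y * g02 * (s + x * B1 + z * B3)
      + z * g03 * (s + x * C1 + y * C2)"
    using nullE[OF p0] unfolding g12 g13 g23 by algebra
  then show False using f0 g03 by simp
qed

section \<open>Obstructions to weak scribability\<close>

lemma weakly_scribed_tangent:
  assumes "spherical_polytope Q" "weakly_scribed k Q" "X \<in> spherical_faces Q" "dim X = Suc k"
  shows "weakly_tangent X"
  using assms by (auto simp: weakly_scribed_def spherical_k_face_iff)

text \<open>Faces are exposed, so the six \<open>F m\<close> provide linear functionals with the
  exact zero pattern that \<open>miquel\<close> asks for. The face \<open>Y\<close> is the base of
  the iterated pyramid and keeps the eight vertices in a space of dimension 4.\<close>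

lemma not_weakly_0_scribed:
  fixes Q :: "(real \<times> (real^'n)) set"
  assumes Q: "spherical_polytope Q" "weakly_scribed 0 Q"
    and Y: "Y \<in> spherical_faces Q" "dim Y \<le> 4"
    and v: "\<And>p. {v p} \<in> spherical_faces Q" "\<And>p. v p \<in> Y"
    and F: "\<And>m. m < 6 \<Longrightarrow> F m \<in> spherical_faces Q"
    and inc: "\<And>m p. m < 6 \<Longrightarrow> v p \<in> F m \<longleftrightarrow> incident m p"
  shows False
proof -
  have "\<exists>a. \<forall>w\<in>Q. w \<in> F m \<longleftrightarrow> a \<bullet> w = 0" if "m < 6" for m
    using spherical_face_exposed[OF Q(1) F[OF that]] by metis
  then obtain a where a: "\<And>m w. m < 6 \<Longrightarrow> w \<in> Q \<Longrightarrow> w \<in> F m \<longleftrightarrow> a m \<bullet> w = 0"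
    by metis
  have vQ: "v p \<in> Q" for p using v(2) spherical_face_subset[OF Q(1) Y(1)] by blast
  show False
  proof (rule miquel[of "span Y" v "\<lambda>m w. a m \<bullet> w"])
    show "lorentz (v p) (v p) = 0" for p
    proof -
      have "norm (v p) = 1" using v(1)[of p] by (auto simp: spherical_faces_def)
      then have "dim {v p} = Suc 0" by (subst dim_singleton) auto
      then obtain r where "r \<in> span {v p}" "r \<noteq> 0" "lorentz r r = 0"
        using weakly_tangentD[OF weakly_scribed_tangent[OF Q v(1)]] by metis
      then show ?thesis by (auto simp: span_singleton lorentz_simps)
    qed
    show "linear ((\<bullet>) (a m))" for m by (simp add: linear_iff inner_simps)
    show "a m \<bullet> v p = 0 \<longleftrightarrow> incident m p" if "m < 6" for m p
      using a[OF that vQ] inc[OF that] by simp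
  qed (use v Y in \<open>auto simp: span_base\<close>)
qed

text \<open>The Gram matrix is twice the identity minus the all-ones matrix, with eigenvalues 2 and
  \<open>2 - card T\<close>. It is invertible as \<open>card T > 2\<close>, whereas that many
  vectors are linearly dependent.\<close>

lemma gram_contradiction:
  fixes T :: "(real \<times> (real^'n)) set"
  assumes "finite T" "card T > DIM(real \<times> (real^'n))"
    and one: "\<And>a. a \<in> T \<Longrightarrow> lorentz a a = 1"
    and minus: "\<And>a b. a \<in> T \<Longrightarrow> b \<in> T \<Longrightarrow> a \<noteq> b \<Longrightarrow> lorentz a b = - 1"
  shows False
proof -
  have "dependent T" using assms(2) dependent_biggerset[of T] assms(1) by blast
  then obtain c w where c: "(\<Sum>a\<in>T. c a *\<^sub>R a) = 0" and w: "w \<in> T" "c w \<noteq> 0"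
    using dependent_finite[OF assms(1)] by blast
  define S where "S = (\<Sum>a\<in>T. c a)"
  have cS: "2 * c b = S" if b: "b \<in> T" for b
  proof -
    have "0 = lorentz (\<Sum>a\<in>T. c a *\<^sub>R a) b" by (simp add: c lorentz_simps)
    also have "\<dots> = (\<Sum>a\<in>T. c a * lorentz a b)"
      by (simp add: linear_sum[OF linear_lorentz(2)] lorentz_simps)
    also have "\<dots> = (\<Sum>a\<in>T. (if a = b then 2 * c b else 0) - c a)"
      by (intro sum.cong refl) (use one minus b in auto)
    also have "\<dots> = 2 * c b - S"
      using b assms(1) by (simp add: sum_subtractf S_def)
    finally show ?thesis by simp
  qed
  have "2 * S = (\<Sum>a\<in>T. 2 * c a)" by (simp add: S_def sum_distrib_left)
  also have "\<dots> = card T * S" using cS by simp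
  finally have "(real (card T) - 2) * S = 0" by (simp add: algebra_simps)
  moreover have "1 + CARD('n) < card T" using assms(2) by simp
  then have "2 < card T" using zero_less_card_finite[where 'a='n] by linarith
  ultimately have "S = 0" by auto
  with cS[OF w(1)] w(2) show False by simp
qed

lemma not_weakly_1_scribed:
  fixes Q :: "(real \<times> (real^'n)) set"
  assumes Q: "spherical_polytope Q" "weakly_scribed 1 Q"
    and V: "finite V" "card V > DIM(real \<times> (real^'n))" "V \<subseteq> Q"
    and E: "\<And>v w. v \<in> V \<Longrightarrow> w \<in> V \<Longrightarrow> v \<noteq> w \<Longrightarrow> E v w \<in> spherical_faces Q"
      "\<And>v w. v \<in> V \<Longrightarrow> w \<in> V \<Longrightarrow> v \<noteq> w \<Longrightarrow> dim (E v w) = 2"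
      "\<And>v w. v \<in> V \<Longrightarrow> w \<in> V \<Longrightarrow> v \<noteq> w \<Longrightarrow> E v w \<inter> V = {v, w}"
  shows False
proof -
  have nv: "norm v = 1" if "v \<in> V" for v
  proof -
    have "Q \<subseteq> sphere 0 1" using spherical_polytopeE[OF Q(1)] by blast
    then show ?thesis using that V(3) by auto
  qed
  have ind: "w \<notin> span {v, u}" if "u \<in> V" "v \<in> V" "w \<in> V" "u \<noteq> v" "w \<noteq> u" "w \<noteq> v" for u v w
  proof
    assume "w \<in> span {v, u}"
    moreover have "span {v, u} \<subseteq> span (E u v)" using E(3) that by (intro span_mono) blast
    ultimately have "w \<in> E u v"
      using spherical_face_eq_span_Int[OF Q(1) E(1)] that V(3) by blast
    with E(3)[of u v] that show False by blast
  qed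
  have third: "\<exists>w\<in>V. w \<noteq> u \<and> w \<noteq> v" for u v
  proof (rule ccontr)
    assume "\<not> ?thesis"
    then have "V \<subseteq> {u, v}" by blast
    then have "card V \<le> 2" using card_mono[of "{u, v}" V] by (simp add: card_insert_if split: if_splits)
    moreover have "1 + CARD('n) < card V" using V(2) by simp
    ultimately show False using zero_less_card_finite[where 'a='n] by linarith
  qed
  have ind2: "v \<notin> span {u}" if uv: "u \<in> V" "v \<in> V" "u \<noteq> v" for u v
  proof -
    obtain w where "w \<in> V" "w \<noteq> u" "w \<noteq> v" using third by blast
    then have "v \<notin> span {w, u}" using ind[of u w v] uv by blast
    then show ?thesis using span_mono[of "{u}" "{w, u}"] by blast
  qed
  have edge: "\<exists>\<alpha> \<beta>. \<alpha> *\<^sub>R u + \<beta> *\<^sub>R v \<noteq> 0 \<and> lorentz (\<alpha> *\<^sub>R u + \<beta> *\<^sub>R v) u = 0 \<and>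
      lorentz (\<alpha> *\<^sub>R u + \<beta> *\<^sub>R v) v = 0 \<and> (\<forall>w\<in>span {u, v}. 0 \<le> lorentz w w)"
    if uv: "u \<in> V" "v \<in> V" "u \<noteq> v" for u v
  proof -
    have "span {u, v} = span (E u v)"
    proof (rule subspace_dim_equal)
      show "span {u, v} \<subseteq> span (E u v)" using E(3) uv by (intro span_mono) blast
      have "independent {v, u}"
        using ind2[OF uv] uv nv[of u] by (intro independent_insertI independent_empty) auto
      then have "dim {v, u} = 2" using uv dim_eq_card_independent[of "{v, u}"] by simp
      then show "dim (span (E u v)) \<le> dim (span {u, v})"
        using E(2) uv by (simp add: insert_commute)
    qed simp_all
    moreover obtain r where r: "r \<in> span (E u v)" "r \<noteq> 0" 
      "\<And>w. w \<in> span (E u v) \<Longrightarrow> lorentz r w = 0" "\<And>w. w \<in> span (E u v) \<Longrightarrow> 0 \<le> lorentz w w"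
      using weakly_tangentD[OF weakly_scribed_tangent[OF Q E(1)[OF uv]]] E(2)[OF uv] by (metis numeral_2_eq_2 One_nat_def)
    ultimately have "r \<in> span {u, v}" by simp
    then obtain \<alpha> \<beta> where "r = \<alpha> *\<^sub>R u + \<beta> *\<^sub>R v" by (rule span_pairE)
    moreover have "u \<in> span (E u v)" "v \<in> span (E u v)"
      using \<open>span {u, v} = span (E u v)\<close> span_base[of u "{u, v}"] span_base[of v "{u, v}"] by auto
    ultimately show ?thesis
      using r \<open>span {u, v} = span (E u v)\<close> by metis
  qed
  \<comment> \<open>A null \<open>v\<close> would be orthogonal to every other vertex, hence to the
    null vector of an edge that misses \<open>v\<close>. Both null vectors would be parallel, and
    \<open>v\<close> would lie in the plane of that edge.\<close>
  have pos: "0 < lorentz v v" if v: "v \<in> V" for v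
  proof -
    obtain u where u: "u \<in> V" "u \<noteq> v" using third by blast
    obtain w where w: "w \<in> V" "w \<noteq> u" "w \<noteq> v" using third by blast
    have orth: "lorentz v x = 0" if "lorentz v v = 0" "x \<in> V" "x \<noteq> v" for x
      using edge[OF v that(2)] that psd_null_orthogonal[of "span {v, x}" v x]
      by (auto simp: span_base)
    have "lorentz v v \<noteq> 0"
    proof
      assume 0: "lorentz v v = 0"
      obtain \<alpha> \<beta> where r: "\<alpha> *\<^sub>R u + \<beta> *\<^sub>R w \<noteq> 0"
        "lorentz (\<alpha> *\<^sub>R u + \<beta> *\<^sub>R w) u = 0" "lorentz (\<alpha> *\<^sub>R u + \<beta> *\<^sub>R w) w = 0"
        using edge[OF u(1) w(1)] w by blast
      define r where "r = \<alpha> *\<^sub>R u + \<beta> *\<^sub>R w"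
      have "lorentz r r = 0" using r(2,3) by (subst (2) r_def) (simp add: lorentz_simps r_def)
      moreover have "lorentz r v = 0"
        using orth[OF 0] u w by (simp add: r_def lorentz_simps lorentz_commute[of _ v])
      ultimately obtain c where "v = c *\<^sub>R r"
        using lorentz_isotropic_parallel[OF _ 0] r(1) r_def by metis
      then have "v = (c * \<alpha>) *\<^sub>R u + (c * \<beta>) *\<^sub>R w" by (simp add: r_def algebra_simps)
      then have "v \<in> span {w, u}"
        by (metis insertI1 insertI2 span_add span_base span_mul)
      then show False using ind[of u w v] u w v by blast
    qed
    moreover have "0 \<le> lorentz v v" using edge[OF v u(1)] u by (auto simp: span_base)
    ultimately show ?thesis by simp
  qed
  \<comment> \<open>The null vector of the edge is a kernel vector of the Gram matrix of
    \<open>u\<close> and \<open>v\<close>, so its determinant vanishes.\<close>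
  have sq: "(lorentz u v)\<^sup>2 = lorentz u u * lorentz v v" if uv: "u \<in> V" "v \<in> V" "u \<noteq> v" for u v
  proof -
    obtain \<alpha> \<beta> where r: "\<alpha> *\<^sub>R u + \<beta> *\<^sub>R v \<noteq> 0"
      "\<alpha> * lorentz u u + \<beta> * lorentz u v = 0" "\<alpha> * lorentz u v + \<beta> * lorentz v v = 0"
      using edge[OF uv] by (auto simp: lorentz_simps lorentz_commute[of v u])
    have "\<alpha> * (lorentz u u * lorentz v v - (lorentz u v)\<^sup>2) = 0"
      "\<beta> * (lorentz u u * lorentz v v - (lorentz u v)\<^sup>2) = 0"
      using r(2,3) by algebra+
    moreover have "\<alpha> \<noteq> 0 \<or> \<beta> \<noteq> 0" using r(1) by auto
    ultimately show ?thesis by auto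
  qed
  obtain v0 where v0: "v0 \<in> V" using third by blast
  define n where "n v = (1 / sqrt (lorentz v v)) *\<^sub>R v" for v :: "real \<times> (real^'n)"
  have n1: "lorentz (n v) (n v) = 1" if "v \<in> V" for v
    using pos[OF that] by (simp add: n_def lorentz_simps field_simps)
  have n2: "(lorentz (n u) (n v))\<^sup>2 = 1" if "u \<in> V" "v \<in> V" "u \<noteq> v" for u v
    using pos[OF that(1)] pos[OF that(2)] sq[OF that]
    by (simp add: n_def lorentz_simps power_divide power_mult_distrib)
  \<comment> \<open>After normalization all products of distinct vertices are 1 or -1; the signs are
    chosen so that those with the reference vertex \<open>v0\<close> are -1.\<close>
  define e where "e v = (if v = v0 then 1 else - lorentz (n v0) (n v)) *\<^sub>R n v" for v
  have e1: "lorentz (e v) (e v) = 1" if "v \<in> V" for v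
    using n1[OF that] n2[OF v0 that] by (auto simp: e_def lorentz_simps power2_eq_square)
  have e0: "lorentz (e v0) (e v) = - 1" if "v \<in> V" "v \<noteq> v0" for v
    using n2[OF v0 that(1)] that by (auto simp: e_def lorentz_simps power2_eq_square)
  have eV: "\<exists>c. c \<noteq> 0 \<and> e v = c *\<^sub>R v" if "v \<in> V" for v
  proof -
    have "lorentz (n v0) (n v) \<noteq> 0" if "v \<noteq> v0" using n2[OF v0 \<open>v \<in> V\<close>] that by auto
    then show ?thesis
      using pos[OF that] by (intro exI[of _ "(if v = v0 then 1 else - lorentz (n v0) (n v)) * (1 / sqrt (lorentz v v))"])
        (auto simp: e_def n_def)
  qed
  have em: "lorentz (e v) (e w) = - 1" if vw: "v \<in> V" "w \<in> V" "v \<noteq> w" for v w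
  proof (cases "v = v0 \<or> w = v0")
    case True
    then show ?thesis using e0 vw lorentz_commute by metis
  next
    case False
    have "(lorentz (n v0) (n v))\<^sup>2 = 1" "(lorentz (n v0) (n w))\<^sup>2 = 1"
      using n2[OF v0 vw(1)] n2[OF v0 vw(2)] False by blast+
    then have "(lorentz (e v) (e w))\<^sup>2 = 1"
      using n2[OF vw] False
      by (simp add: e_def lorentz_simps power_mult_distrib)
    then consider "lorentz (e v) (e w) = 1" | "lorentz (e v) (e w) = - 1"
      by (auto simp: power2_eq_1_iff)
    then show ?thesis
    proof cases
      case 1
      \<comment> \<open>If the product were 1, then \<open>a\<close> and \<open>b\<close> would be
        null and orthogonal, hence parallel, and \<open>v0\<close>, \<open>v\<close>,
        \<open>w\<close> would be dependent.\<close>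
      define a b where ab: "a = e v0 + e v" "b = e v0 + e w"
      have "lorentz a a = 0" "lorentz b b = 0" "lorentz a b = 0"
        using e1[OF v0] e1[OF vw(1)] e1[OF vw(2)] e0[OF vw(1)] e0[OF vw(2)] False 1
        by (simp_all add: ab lorentz_simps lorentz_commute[of "e v" "e v0"] lorentz_commute[of "e w" "e v0"])
      obtain x where x: "x \<noteq> 0" "e v = x *\<^sub>R v" using eV vw by blast
      obtain y where y: "y \<noteq> 0" "e w = y *\<^sub>R w" using eV vw by blast
      obtain z where z: "e v0 = z *\<^sub>R v0" using eV v0 by blast
      have "a \<noteq> 0"
      proof
        assume "a = 0"
        then have "x *\<^sub>R v = (- z) *\<^sub>R v0" using x z by (simp add: ab add_eq_0_iff2)
        then have "v = (- z / x) *\<^sub>R v0" using scaleR_eq_imp_eq_divide x(1) by blast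
        then have "v \<in> span {v0}" by (metis insertI1 span_base span_mul)
        then show False using ind2[OF v0 vw(1)] False by blast
      qed
      then obtain c where "b = c *\<^sub>R a"
        using lorentz_isotropic_parallel \<open>lorentz a a = 0\<close> \<open>lorentz b b = 0\<close> \<open>lorentz a b = 0\<close>
        by metis
      then have "y *\<^sub>R w = (c * x) *\<^sub>R v + ((c - 1) * z) *\<^sub>R v0"
        using x y z by (simp add: ab algebra_simps)
      moreover have "w = (1 / y) *\<^sub>R (y *\<^sub>R w)" using y(1) by simp
      ultimately have "w = (1 / y) *\<^sub>R ((c * x) *\<^sub>R v + ((c - 1) * z) *\<^sub>R v0)" by simp
      then have "w \<in> span {v, v0}"
        by (metis insertI1 insertI2 span_add span_base span_mul)
      then show ?thesis using ind[OF v0 vw(1,2)] False vw by blast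
    qed
  qed
  have "inj_on e V"
    using e1 em by (intro inj_onI) (metis one_neq_neg_one)
  then have "card (e ` V) > DIM(real \<times> (real^'n))" using V(2) by (simp add: card_image)
  then show False
  proof (rule gram_contradiction[rotated])
    fix a b assume "a \<in> e ` V" "b \<in> e ` V" "a \<noteq> b"
    then show "lorentz a b = - 1" using em by blast
  next
    fix a assume "a \<in> e ` V"
    then show "lorentz a a = 1" using e1 by blast
  qed (use V(1) in blast)
qed

text \<open>Here \<open>dim\<close> is linear: \<open>Y\<close> is a \<open>(k + 1)\<close>-face and
  the \<open>X p\<close> are facets of it around \<open>Z\<close>. The null vector
  \<open>r p\<close> of \<open>X p\<close> is orthogonal to \<open>span Z\<close>, and the
  orthogonal complement of \<open>Z\<close> in \<open>span Y\<close> has dimension at most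
  \<open>(k + 2) - (k - 2) = 4\<close>.\<close>

lemma not_weakly_k_scribed:
  fixes Q :: "(real \<times> (real^'n)) set"
  assumes Q: "spherical_polytope Q" "weakly_scribed k Q"
    and Y: "Y \<in> spherical_faces Q" "dim Y = k + 2"
    and Z: "Z \<in> spherical_faces Q" "k \<le> dim Z + 2" "Z \<subseteq> Y"
    and X: "\<And>p. X p \<in> spherical_faces Q" "\<And>p. dim (X p) = k + 1" "\<And>p. Z \<subseteq> X p" "\<And>p. X p \<subseteq> Y"
    and v: "\<And>m. m < 6 \<Longrightarrow> v m \<in> Y" "\<And>m p. m < 6 \<Longrightarrow> v m \<in> X p \<longleftrightarrow> incident m p"
  shows False
proof -
  define W where "W = span Y"
  have "\<exists>r. r \<in> span (X p) \<and> r \<noteq> 0 \<and> lorentz r r = 0 \<and> (\<forall>w\<in>span (X p). lorentz r w = 0)" for p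
    using weakly_tangentD[OF weakly_scribed_tangent[OF Q X(1)[of p]]] X(2)[of p] 
    by (metis Suc_eq_plus1)
  then obtain r where r: "\<And>p. r p \<in> span (X p)" "\<And>p. r p \<noteq> 0" "\<And>p. lorentz (r p) (r p) = 0"
    "\<And>p w. w \<in> span (X p) \<Longrightarrow> lorentz (r p) w = 0"
    by metis
  have XW: "span (X p) \<subseteq> W" for p unfolding W_def by (intro span_mono X)
  have rW: "r p \<in> W" for p using r(1) XW by blast
  have split: "W = span (insert y (X p))" if "y \<in> Y" "y \<notin> X p" for y p
    unfolding W_def
  proof (rule subspace_dim_equal[symmetric])
    show "span (insert y (X p)) \<subseteq> span Y" using X(4) that by (intro span_mono) auto
    have "y \<notin> span (X p)"
      using spherical_face_eq_span_Int[OF Q(1) X(1)[of p]] that spherical_face_subset[OF Q(1) Y(1)] by blast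
    then show "dim (span Y) \<le> dim (span (insert y (X p)))"
      using Y X(2) by (simp add: dim_insert)
  qed simp_all
  \<comment> \<open>Otherwise \<open>r p\<close> is orthogonal to all of \<open>W\<close>. Some
    facet \<open>F\<close> of \<open>Y\<close> has a span avoiding \<open>r p\<close>, but
    \<open>F\<close> is a \<open>k\<close>-face and contains a null vector \<open>s\<close>; being
    orthogonal, \<open>r p\<close> and \<open>s\<close> are parallel.\<close>
  have nz: "lorentz (r p) y \<noteq> 0" if y: "y \<in> Y" "y \<notin> X p" for y p
  proof
    assume 0: "lorentz (r p) y = 0"
    have "W \<subseteq> {x. lorentz (r p) x = 0}"
      unfolding split[OF y]
      using 0 r(4)[of _ p] span_base[of _ "X p"]
      by (intro span_minimal subspace_lorentz_orthogonal) blast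
    then have orth: "lorentz (r p) w = 0" if "w \<in> W" for w using that by blast
    obtain F where F: "F \<in> spherical_faces Q" "F \<subset> Y" "dim Y = Suc (dim F)" "r p \<notin> span F"
      using span_facets_avoid[OF Q(1) Y(1) _ r(2)[of p]] rW unfolding W_def by metis
    have "dim F = Suc k" using F(3) Y(2) by simp
    then obtain s where s: "s \<in> span F" "s \<noteq> 0" "lorentz s s = 0"
      using weakly_tangentD[OF weakly_scribed_tangent[OF Q F(1)]] by metis
    have "s \<in> W" using s(1) F(2) span_mono[of F Y] unfolding W_def by blast
    then obtain c where "r p = c *\<^sub>R s"
      using lorentz_isotropic_parallel[OF s(3) r(3)[of p] _ s(2)] orth[of s] lorentz_commute by metis
    then show False using F(4) s(1) span_mul by metis
  qed
  have nondeg: "x = 0" if x: "x \<in> W" "\<And>w. w \<in> W \<Longrightarrow> lorentz x w = 0" for x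
  proof -
    define p where "p = (True, True, True)"
    have y: "v 0 \<in> Y" "v 0 \<notin> X p" using v by (auto simp: p_def)
    obtain c where "x = c *\<^sub>R r p"
      using lorentz_isotropic_parallel[OF r(3) x(2)[OF x(1)] _ r(2)] x rW lorentz_commute by metis
    moreover have "lorentz x (v 0) = 0" using x(2) y(1) by (simp add: W_def span_base)
    ultimately show ?thesis using nz[OF y] by (simp add: lorentz_simps)
  qed
  define U where "U = {x \<in> W. \<forall>z\<in>span Z. lorentz x z = 0}"
  define J :: "real \<times> (real^'n) \<Rightarrow> real \<times> (real^'n)" where "J x = (- fst x, snd x)" for x
  have J: "lorentz x y = J x \<bullet> y" "lorentz x y = x \<bullet> J y" for x y
    by (auto simp: lorentz_def J_def inner_prod_def)
  have linJ: "linear J" by (auto simp: J_def linear_iff)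
  have "J (J x) = x" for x by (simp add: J_def)
  then have injJ: "inj J" by (metis injI)
  define W' where "W' = {y. \<forall>x\<in>W. orthogonal x y}"
  have subW': "subspace W'" by (auto simp: W'_def orthogonal_def subspace_def inner_simps)
  have dW': "dim W' + dim W = DIM(real \<times> (real^'n))"
    using dim_subspace_orthogonal_to_vectors[of W UNIV] by (simp add: W_def W'_def)
  have ZW: "span Z \<subseteq> W" unfolding W_def by (intro span_mono Z)
  have subJ: "subspace (J ` span Z)" by (simp add: linJ linear_subspace_image)
  have "J ` span Z \<inter> W' = {0}"
  proof -
    have "z = 0" if "z \<in> span Z" "J z \<in> W'" for z
    proof (rule nondeg)
      show "lorentz z w = 0" if "w \<in> W" for w
        using \<open>J z \<in> W'\<close> that J(2)[of w z] lorentz_commute[of z w] by (simp add: W'_def orthogonal_def)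
    qed (use that ZW in blast)
    then have "x = 0" if "x \<in> J ` span Z \<inter> W'" for x
      using that linear_0[OF linJ] by blast
    then show ?thesis
      using subspace_0[OF subJ] subspace_0[OF subW'] by blast
  qed
  define A where "A = {x + y |x y. x \<in> J ` span Z \<and> y \<in> W'}"
  have "dim A + dim {0::real \<times> (real^'n)} = dim (J ` span Z) + dim W'"
    unfolding A_def using dim_sums_Int[OF subJ subW'] \<open>J ` span Z \<inter> W' = {0}\<close> by simp
  moreover have "dim (J ` span Z) = dim Z" using dim_image_eq[OF linJ] injJ by (metis dim_span inj_on_subset subset_UNIV)
  ultimately have dA: "dim A = dim Z + dim W'" by simp
  have "subspace A" unfolding A_def by (rule subspace_sums[OF subJ subW'])
  then have "dim {y. \<forall>x\<in>A. orthogonal x y} + dim A = DIM(real \<times> (real^'n))"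
    using dim_subspace_orthogonal_to_vectors[of A UNIV] by simp
  moreover have "U \<subseteq> {y. \<forall>x\<in>A. orthogonal x y}"
  proof (clarify)
    fix x a assume x: "x \<in> U" and "a \<in> A"
    then obtain z w where a: "a = J z + w" "z \<in> span Z" "w \<in> W'" by (auto simp only: A_def)
    have "J z \<bullet> x = 0" using x a(2) J(1)[of z x] lorentz_commute[of x z] by (simp add: U_def)
    moreover have "x \<bullet> w = 0" using x a(3) by (simp add: U_def W'_def orthogonal_def)
    then have "w \<bullet> x = 0" by (simp only: inner_commute)
    ultimately show "orthogonal a x" by (simp add: orthogonal_def a(1) inner_left_distrib)
  qed
  then have "dim U \<le> dim {y. \<forall>x\<in>A. orthogonal x y}" by (rule dim_subset)
  ultimately have "dim U + dim A \<le> DIM(real \<times> (real^'n))" by linarith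
  moreover have "dim W = k + 2" using Y(2) by (simp add: W_def)
  ultimately have dU: "dim U \<le> 4" using dA dW' Z(2) by linarith
  have sU: "subspace U"
    unfolding U_def W_def
    by (rule subspaceI) (simp_all add: lorentz_simps span_zero span_add span_mul)
  show False
  proof (rule miquel[of U r "\<lambda>m x. lorentz x (v m)"])
    show "r p \<in> U" for p
      unfolding U_def using rW r(4)[of _ p] span_mono[OF X(3)[of p]] by blast
    show "lorentz (r p) (v m) = 0 \<longleftrightarrow> incident m p" if m: "m < 6" for m p
      using nz[OF v(1)[OF m], of p] r(4)[of "v m" p] v(2)[OF m, of p] by (auto simp: span_base)
  qed (auto simp: sU dU r(3) linear_lorentz)
qed

section \<open>Spherical polytopes from inequalities\<close>

definition ineq_cone :: "'a::euclidean_space set \<Rightarrow> 'a set" where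
  "ineq_cone A = {x. \<forall>a\<in>A. 0 \<le> a \<bullet> x}"

definition ineq_face :: "'a::euclidean_space set \<Rightarrow> 'a set \<Rightarrow> 'a set" where
  "ineq_face A B = {x \<in> ineq_cone A. \<forall>a\<in>B. a \<bullet> x = 0} \<inter> sphere 0 1"

locale pointed_ineq_cone =
  fixes A :: "'a::euclidean_space set"
  assumes fin: "finite A" and nz: "0 \<notin> A"
    and pointed: "\<And>x. (\<And>a. a \<in> A \<Longrightarrow> a \<bullet> x = 0) \<Longrightarrow> x = 0"
    and interior: "\<exists>x. \<forall>a\<in>A. 0 < a \<bullet> x"
begin

definition cone_polytope :: "'a set" where
  "cone_polytope = ineq_cone A \<inter> sphere 0 1"

lemma cone_polytope_eq: "cone_polytope = sphere 0 1 \<inter> (\<Inter>a\<in>A. closed_hemisphere a)"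
  by (auto simp: cone_polytope_def ineq_cone_def closed_hemisphere_def)

lemma cone_over_cone_polytope: "cone_over cone_polytope = ineq_cone A"
  unfolding cone_polytope_eq cone_over_hemispheres ineq_cone_def ..

lemma spherical_polytope_cone_polytope: "spherical_polytope cone_polytope"
  unfolding spherical_polytope_def
proof (intro conjI ballI notI)
  show "\<exists>A. finite A \<and> 0 \<notin> A \<and> cone_polytope = sphere 0 1 \<inter> \<Inter> (closed_hemisphere ` A)"
    using fin nz cone_polytope_eq by blast
  fix x assume "x \<in> cone_polytope" "- x \<in> cone_polytope"
  then have "a \<bullet> x = 0" if "a \<in> A" for a
    using that by (auto simp: cone_polytope_def ineq_cone_def intro: antisym)
  then have "x = 0" using pointed by blast
  with \<open>x \<in> cone_polytope\<close> show False by (simp add: cone_polytope_def)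
qed

lemma spherical_d_polytope_cone_polytope:
  assumes "DIM('a) = Suc d"
  shows "spherical_d_polytope d cone_polytope"
proof -
  obtain x where x: "\<And>a. a \<in> A \<Longrightarrow> 0 < a \<bullet> x" using interior by blast
  have "open (\<Inter>a\<in>A. {y. 0 < a \<bullet> y})"
    using fin by (auto intro!: open_INT open_halfspace_gt[of 0, simplified])
  moreover have "(\<Inter>a\<in>A. {y. 0 < a \<bullet> y}) \<subseteq> ineq_cone A"
    by (auto simp: ineq_cone_def less_imp_le)
  ultimately have "(\<Inter>a\<in>A. {y. 0 < a \<bullet> y}) \<subseteq> interior (ineq_cone A)"
    by (rule interior_maximal[rotated])
  then have "interior (ineq_cone A) \<noteq> {}" using x by auto
  then have "aff_dim (ineq_cone A) = DIM('a)" by (rule aff_dim_nonempty_interior)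
  then show ?thesis
    using spherical_polytope_cone_polytope assms
    by (simp add: spherical_d_polytope_def spherical_dim_def cone_over_cone_polytope)
qed

lemma ineq_face_in_faces:
  assumes "B \<subseteq> A"
  shows "ineq_face A B \<in> spherical_faces cone_polytope"
proof -
  have conv: "convex (ineq_cone A)"
    using convex_cone_over[OF spherical_polytope_cone_polytope] cone_over_cone_polytope by simp
  have face: "ineq_cone A \<inter> {x. a \<bullet> x = 0} face_of ineq_cone A" if "a \<in> A" for a
    by (rule face_of_Int_supporting_hyperplane_ge[OF conv]) (use that in \<open>auto simp: ineq_cone_def\<close>)
  have "ineq_cone A \<inter> \<Inter> ((\<lambda>a. ineq_cone A \<inter> {x. a \<bullet> x = 0}) ` B) face_of ineq_cone A"
  proof (cases "B = {}")
    case False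
    have "\<Inter> ((\<lambda>a. ineq_cone A \<inter> {x. a \<bullet> x = 0}) ` B) face_of ineq_cone A"
      using False assms
      by (intro face_of_Inter) (auto intro: face)
    then show ?thesis by (simp add: face_of_Int face_of_refl conv)
  qed (simp add: face_of_refl conv)
  moreover have "ineq_cone A \<inter> \<Inter> ((\<lambda>a. ineq_cone A \<inter> {x. a \<bullet> x = 0}) ` B)
      = {x \<in> ineq_cone A. \<forall>a\<in>B. a \<bullet> x = 0}"
    by auto
  ultimately show ?thesis
    unfolding spherical_faces_def ineq_face_def cone_over_cone_polytope by auto
qed

lemma sgn_in_ineq_face:
  assumes "v \<noteq> 0" "v \<in> ineq_cone A"
  shows "sgn v \<in> ineq_face A B \<longleftrightarrow> (\<forall>a\<in>B. a \<bullet> v = 0)"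
  using assms by (auto simp: ineq_face_def ineq_cone_def sgn_div_norm)

text \<open>Reduces being a vertex to linear algebra: the tight constraints \<open>B\<close> leave
  only the line through \<open>v\<close>, so the face they cut out has dimension 1 and is a single
  point.\<close>

lemma vertexI:
  assumes v: "v \<noteq> 0" "v \<in> ineq_cone A" and B: "B \<subseteq> A" "\<And>a. a \<in> B \<Longrightarrow> a \<bullet> v = 0"
    and span: "\<And>x. (\<And>a. a \<in> B \<Longrightarrow> a \<bullet> x = 0) \<Longrightarrow> x \<in> span {v}"
  shows "{sgn v} \<in> spherical_faces cone_polytope"
proof -
  have F: "ineq_face A B \<in> spherical_faces cone_polytope" by (rule ineq_face_in_faces[OF B(1)])
  have s: "sgn v \<in> ineq_face A B" using v B by (simp add: sgn_in_ineq_face)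
  have "ineq_face A B \<subseteq> span {v}" using span by (auto simp: ineq_face_def)
  then have "dim (ineq_face A B) \<le> dim (span {v})" by (rule dim_subset)
  then have "dim (ineq_face A B) \<le> 1" using v by (simp add: dim_singleton)
  moreover have "dim {sgn v} \<le> dim (ineq_face A B)" by (rule dim_subset) (use s in simp)
  moreover have "dim {sgn v} = 1" using v by (subst dim_singleton) (auto simp: sgn_zero_iff)
  ultimately have "dim (ineq_face A B) = 1" by simp
  then obtain w where "ineq_face A B = {w}"
    using spherical_face_dim_1[OF spherical_polytope_cone_polytope F] by blast
  then show ?thesis using F s by auto
qed

end

section \<open>A cube with one broken facet, its dual, and pyramids over them\<close>

text \<open>\<open>pt (i, j, k)\<close> are the vertices of the unit cube, where the corner at the origin is moved
  along an edge, so that the facet with normal \<open>nrm 4\<close> loses this vertex.  The seven normals and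
  the eight points are used once as facet normals and once as generators; the coordinates
  outside the first four only add apexes of iterated pyramids.\<close>

locale four_axes =
  fixes \<tau> \<xi> \<eta> \<zeta> :: "'a::euclidean_space" and R :: "'a set"
  assumes distinct: "distinct [\<tau>, \<xi>, \<eta>, \<zeta>]" and Basis: "{\<tau>, \<xi>, \<eta>, \<zeta>} \<subseteq> Basis"
    and R: "R = Basis - {\<tau>, \<xi>, \<eta>, \<zeta>}"
begin

text \<open>With \<open>\<tau>\<close> as homogenizing coordinate, 0 to 5 are the facets of the unit
  cube. The last normal is the plane through \<open>(1,0,0)\<close>, \<open>(0,1,0)\<close> and the
  moved corner \<open>(0,0,1/2)\<close>, the second triangle of the broken facet.\<close>

definition nrm :: "nat \<Rightarrow> 'a" where
  "nrm m = (if m = 0 then \<xi> else if m = 1 then \<tau> - \<xi> else if m = 2 then \<eta> else if m = 3 then \<tau> - \<eta>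
    else if m = 4 then \<zeta> else if m = 5 then \<tau> - \<zeta> else \<xi> + \<eta> + 2 *\<^sub>R \<zeta> - \<tau>)"

fun pt :: "bool \<times> bool \<times> bool \<Rightarrow> 'a" where
  "pt (i, j, k) = \<tau> + of_bool i *\<^sub>R \<xi> + of_bool j *\<^sub>R \<eta>
     + (if k then 1 else if i \<or> j then 0 else 1/2) *\<^sub>R \<zeta>"

declare pt.simps [simp del]

lemma axes: "\<tau> \<bullet> \<tau> = 1" "\<xi> \<bullet> \<xi> = 1" "\<eta> \<bullet> \<eta> = 1" "\<zeta> \<bullet> \<zeta> = 1"
  "\<tau> \<bullet> \<xi> = 0" "\<tau> \<bullet> \<eta> = 0" "\<tau> \<bullet> \<zeta> = 0" "\<xi> \<bullet> \<tau> = 0" "\<xi> \<bullet> \<eta> = 0" "\<xi> \<bullet> \<zeta> = 0"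
  "\<eta> \<bullet> \<tau> = 0" "\<eta> \<bullet> \<xi> = 0" "\<eta> \<bullet> \<zeta> = 0" "\<zeta> \<bullet> \<tau> = 0" "\<zeta> \<bullet> \<xi> = 0" "\<zeta> \<bullet> \<eta> = 0"
  using distinct Basis by (auto simp: inner_Basis)

lemma axes_R: "b \<in> R \<Longrightarrow> b \<bullet> \<tau> = 0" "b \<in> R \<Longrightarrow> b \<bullet> \<xi> = 0" "b \<in> R \<Longrightarrow> b \<bullet> \<eta> = 0" "b \<in> R \<Longrightarrow> b \<bullet> \<zeta> = 0"
  "b \<in> R \<Longrightarrow> \<tau> \<bullet> b = 0" "b \<in> R \<Longrightarrow> \<xi> \<bullet> b = 0" "b \<in> R \<Longrightarrow> \<eta> \<bullet> b = 0" "b \<in> R \<Longrightarrow> \<zeta> \<bullet> b = 0"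
  using Basis R by (auto simp: inner_Basis)

lemma fin_R: "finite R" using R by simp

lemma zero_notin_R: "0 \<notin> R" using R by auto

lemma R_inner: "b \<in> R \<Longrightarrow> b' \<in> R \<Longrightarrow> b \<bullet> b' = (if b = b' then 1 else 0)"
  using R by (simp add: inner_Basis)

lemma R_nrm: "b \<in> R \<Longrightarrow> b \<bullet> nrm m = 0"
  by (simp add: nrm_def inner_simps axes_R)

lemma R_pt: "b \<in> R \<Longrightarrow> b \<bullet> pt p = 0"
  by (cases p) (simp add: pt.simps inner_simps axes_R)

lemma inner_sum_R: "\<tau> \<bullet> \<Sum>R = 0" "\<xi> \<bullet> \<Sum>R = 0" "\<eta> \<bullet> \<Sum>R = 0" "\<zeta> \<bullet> \<Sum>R = 0"
  "b \<in> R \<Longrightarrow> b \<bullet> \<Sum>R = 1"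
  using fin_R by (simp_all add: inner_sum_right axes_R R_inner)

lemma eqI: 
  assumes "\<tau> \<bullet> x = \<tau> \<bullet> y" "\<xi> \<bullet> x = \<xi> \<bullet> y" "\<eta> \<bullet> x = \<eta> \<bullet> y" "\<zeta> \<bullet> x = \<zeta> \<bullet> y" "\<And>b. b \<in> R \<Longrightarrow> b \<bullet> x = b \<bullet> y"
  shows "x = y"
proof (rule euclidean_eqI)
  fix b :: 'a assume "b \<in> Basis"
  then have "b \<in> {\<tau>, \<xi>, \<eta>, \<zeta>} \<or> b \<in> R" using R by blast
  then show "x \<bullet> b = y \<bullet> b" using assms by (auto simp: inner_commute)
qed

lemma pt_inner: "pt (i, j, k) \<bullet> nrm m = (if m = 0 then of_bool i else if m = 1 then 1 - of_bool i
    else if m = 2 then of_bool j else if m = 3 then 1 - of_bool j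
    else let z = (if k then 1 else if i \<or> j then 0 else 1/2)
      in if m = 4 then z else if m = 5 then 1 - z else of_bool i + of_bool j + 2 * z - 1)"
proof -
  consider "m = 0" | "m = 1" | "m = 2" | "m = 3" | "m = 4" | "m = 5" | "m \<ge> 6" by linarith
  then show ?thesis
    by cases (simp_all add: nrm_def pt.simps inner_simps axes)
qed

lemma pt_nrm: "0 \<le> pt p \<bullet> nrm m" "m < 6 \<Longrightarrow> pt p \<bullet> nrm m = 0 \<longleftrightarrow> incident m p"
proof -
  obtain i j k where p: "p = (i, j, k)" by (cases p)
  show "0 \<le> pt p \<bullet> nrm m"
    by (cases i; cases j; cases k) (simp_all add: p pt_inner Let_def)
  consider "m = 0" | "m = 1" | "m = 2" | "m = 3" | "m = 4" | "m = 5" | "m \<ge> 6" by linarith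
  then show "pt p \<bullet> nrm m = 0 \<longleftrightarrow> incident m p" if "m < 6"
    using that by cases (auto simp: p pt_inner Let_def)
qed

lemma pt_axes: "pt p \<bullet> \<tau> = 1" "0 \<le> pt p \<bullet> \<xi>" "0 \<le> pt p \<bullet> \<eta>" "0 \<le> pt p \<bullet> \<zeta>"
  by (cases p, simp add: pt.simps inner_simps axes)+

lemma pt_nz: "pt p \<noteq> 0"
  using pt_axes(1)[of p] by auto

lemma nrm_nz: "nrm m \<noteq> 0"
proof
  assume "nrm m = 0"
  then have "\<xi> \<bullet> nrm m = 0" "\<eta> \<bullet> nrm m = 0" "\<zeta> \<bullet> nrm m = 0" by simp_all
  then show False by (auto simp: nrm_def inner_simps axes split: if_splits)
qed

subsection \<open>The broken cube\<close>

definition A0 :: "'a set" where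
  "A0 = nrm ` {..6} \<union> R"

sublocale broken_cube: pointed_ineq_cone A0
proof
  show "finite A0" by (simp add: A0_def fin_R)
  show "0 \<notin> A0" using nrm_nz zero_notin_R by (auto simp: A0_def)
next
  fix x assume x: "\<And>a. a \<in> A0 \<Longrightarrow> a \<bullet> x = 0"
  have "nrm m \<bullet> x = 0" if "m \<le> 6" for m using x that by (auto simp: A0_def)
  from this[of 0] this[of 1] this[of 2] this[of 4]
  show "x = 0" by (intro eqI) (auto simp: nrm_def inner_simps intro: x simp: A0_def)
next
  have "0 < nrm m \<bullet> (\<tau> + (1/2) *\<^sub>R \<xi> + (1/2) *\<^sub>R \<eta> + (1/2) *\<^sub>R \<zeta> + \<Sum>R)" for m
    by (simp add: nrm_def inner_simps axes inner_sum_R)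
  moreover have "0 < b \<bullet> (\<tau> + (1/2) *\<^sub>R \<xi> + (1/2) *\<^sub>R \<eta> + (1/2) *\<^sub>R \<zeta> + \<Sum>R)" if "b \<in> R" for b
    using that by (simp add: inner_simps axes_R inner_sum_R)
  ultimately show "\<exists>x. \<forall>a\<in>A0. 0 < a \<bullet> x" by (auto simp: A0_def)
qed

lemma pt_in_cone: "pt p \<in> ineq_cone A0"
proof -
  have "0 \<le> nrm m \<bullet> pt p" for m using pt_nrm(1)[of p m] by (simp only: inner_commute)
  then show ?thesis using R_pt[of _ p] by (auto simp: ineq_cone_def A0_def)
qed

lemma pt_vertex: "{sgn (pt p)} \<in> spherical_faces broken_cube.cone_polytope"
proof (rule broken_cube.vertexI[OF pt_nz pt_in_cone])
  let ?B = "{a \<in> A0. a \<bullet> pt p = 0}"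
  show "?B \<subseteq> A0" by blast
  show "a \<bullet> pt p = 0" if "a \<in> ?B" for a using that by blast
  fix x assume x: "\<And>a. a \<in> ?B \<Longrightarrow> a \<bullet> x = 0"
  have n: "nrm m \<bullet> pt p = 0 \<Longrightarrow> nrm m \<bullet> x = 0" if "m \<le> 6" for m
    using x that by (auto simp: A0_def)
  have R0: "b \<bullet> x = 0" if "b \<in> R" for b
    using x[of b] R_pt[OF that] that by (auto simp: A0_def)
  note n' = n[of 0] n[of 1] n[of 2] n[of 3] n[of 4] n[of 5] n[of 6]
  \<comment> \<open>At each corner one facet of every opposite pair is tight, with facet 6 replacing
    4 at the moved corner. These equations make the other axis coordinates multiples of
    \<open>\<tau> \<bullet> x\<close>.\<close>
  have "x = (\<tau> \<bullet> x) *\<^sub>R pt p"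
  proof (rule eqI)
    obtain i j k where p: "p = (i, j, k)" by (cases p)
    show "\<tau> \<bullet> x = \<tau> \<bullet> ((\<tau> \<bullet> x) *\<^sub>R pt p)" by (simp add: pt_axes inner_commute[of _ "pt p"])
    show "\<xi> \<bullet> x = \<xi> \<bullet> ((\<tau> \<bullet> x) *\<^sub>R pt p)" "\<eta> \<bullet> x = \<eta> \<bullet> ((\<tau> \<bullet> x) *\<^sub>R pt p)"
      "\<zeta> \<bullet> x = \<zeta> \<bullet> ((\<tau> \<bullet> x) *\<^sub>R pt p)"
      using n' unfolding p
      by (cases i; cases j; cases k; simp add: nrm_def pt.simps inner_simps axes)+
    show "b \<bullet> x = b \<bullet> ((\<tau> \<bullet> x) *\<^sub>R pt p)" if "b \<in> R" for b
      using that by (simp add: R0 R_pt)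
  qed
  then show "x \<in> span {pt p}" by (metis insertI1 span_base span_mul)
qed

lemma broken_cube_faces: "m < 6 \<Longrightarrow> ineq_face A0 {nrm m} \<in> spherical_faces broken_cube.cone_polytope"
  "ineq_face A0 R \<in> spherical_faces broken_cube.cone_polytope"
  by (intro broken_cube.ineq_face_in_faces; auto simp: A0_def)+

lemma dim_base: "dim (ineq_face A0 R) \<le> 4"
proof -
  have "ineq_face A0 R \<subseteq> span {\<tau>, \<xi>, \<eta>, \<zeta>}"
  proof
    fix x assume "x \<in> ineq_face A0 R"
    then have x: "b \<bullet> x = 0" if "b \<in> R" for b using that by (auto simp: ineq_face_def)
    have "x = (\<tau> \<bullet> x) *\<^sub>R \<tau> + (\<xi> \<bullet> x) *\<^sub>R \<xi> + (\<eta> \<bullet> x) *\<^sub>R \<eta> + (\<zeta> \<bullet> x) *\<^sub>R \<zeta>"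
      by (rule eqI) (simp_all add: inner_simps axes axes_R x)
    then show "x \<in> span {\<tau>, \<xi>, \<eta>, \<zeta>}"
      by (metis insertI1 insertI2 span_add span_base span_mul)
  qed
  then have "dim (ineq_face A0 R) \<le> card {\<tau>, \<xi>, \<eta>, \<zeta>}" by (intro dim_le_card) auto
  also have "\<dots> \<le> 4" by (simp add: card_insert_if)
  finally show ?thesis .
qed

subsection \<open>The dual\<close>

definition A2 :: "'a set" where
  "A2 = range pt \<union> R"

sublocale dual: pointed_ineq_cone A2
proof
  show "finite A2" by (simp add: A2_def fin_R)
  show "0 \<notin> A2" using pt_nz zero_notin_R by (auto simp: A2_def)
next
  fix x assume x: "\<And>a. a \<in> A2 \<Longrightarrow> a \<bullet> x = 0"
  have "pt p \<bullet> x = 0" for p using x by (auto simp: A2_def)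
  from this[of "(True, True, True)"] this[of "(True, True, False)"]
    this[of "(True, False, True)"] this[of "(False, True, True)"]
  show "x = 0" by (intro eqI) (auto simp: pt.simps inner_simps intro: x simp: A2_def)
next
  have "0 < pt p \<bullet> (\<tau> + \<Sum>R)" for p
    by (cases p) (simp add: pt.simps inner_simps axes inner_sum_R)
  moreover have "0 < b \<bullet> (\<tau> + \<Sum>R)" if "b \<in> R" for b
    using that by (simp add: inner_simps axes_R inner_sum_R)
  ultimately show "\<exists>x. \<forall>a\<in>A2. 0 < a \<bullet> x"
    by (intro exI[of _ "\<tau> + \<Sum>R"]) (auto simp: A2_def)
qed

lemma nrm_in_cone: "nrm m \<in> ineq_cone A2"
  using pt_nrm(1) R_nrm by (auto simp: ineq_cone_def A2_def)

lemma nrm_vertex: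
  assumes m: "m < 6"
  shows "{sgn (nrm m)} \<in> spherical_faces dual.cone_polytope"
proof (rule dual.vertexI[OF nrm_nz nrm_in_cone])
  let ?B = "{a \<in> A2. a \<bullet> nrm m = 0}"
  show "?B \<subseteq> A2" by blast
  show "a \<bullet> nrm m = 0" if "a \<in> ?B" for a using that by blast
  fix x assume x: "\<And>a. a \<in> ?B \<Longrightarrow> a \<bullet> x = 0"
  have n: "incident m p \<Longrightarrow> pt p \<bullet> x = 0" for p
    using x[of "pt p"] pt_nrm(2)[OF m, of p] by (auto simp: A2_def)
  have R0: "b \<bullet> x = 0" if "b \<in> R" for b
    using x[of b] R_nrm[OF that] that by (auto simp: A2_def)
  have e: "incident m (i, j, k) \<Longrightarrow> \<tau> \<bullet> x + of_bool i * (\<xi> \<bullet> x) + of_bool j * (\<eta> \<bullet> x)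
      + (if k then 1 else if i \<or> j then 0 else 1/2) * (\<zeta> \<bullet> x) = 0" for i j k
    using n[of "(i, j, k)"] by (simp only: pt.simps inner_add_left inner_scaleR_left)
  \<comment> \<open>A coordinate in which \<open>nrm m\<close> has coefficient 1. In each case below
    three corners of facet \<open>m\<close>, never the moved one, give enough equations.\<close>
  define c where "c = (if m = 0 then \<xi> \<bullet> x else if m = 2 then \<eta> \<bullet> x else if m = 4 then \<zeta> \<bullet> x else \<tau> \<bullet> x)"
  consider "m = 0" | "m = 1" | "m = 2" | "m = 3" | "m = 4" | "m = 5" using m by linarith
  then have "\<tau> \<bullet> x = c * (\<tau> \<bullet> nrm m) \<and> \<xi> \<bullet> x = c * (\<xi> \<bullet> nrm m)
      \<and> \<eta> \<bullet> x = c * (\<eta> \<bullet> nrm m) \<and> \<zeta> \<bullet> x = c * (\<zeta> \<bullet> nrm m)"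
  proof cases
    case 1
    then show ?thesis using e[of False True True] e[of False True False] e[of False False True]
      by (simp add: c_def nrm_def inner_simps axes)
  next
    case 2
    then show ?thesis using e[of True True True] e[of True True False] e[of True False True]
      by (simp add: c_def nrm_def inner_simps axes)
  next
    case 3
    then show ?thesis using e[of True False True] e[of True False False] e[of False False True]
      by (simp add: c_def nrm_def inner_simps axes)
  next
    case 4
    then show ?thesis using e[of True True True] e[of True True False] e[of False True True]
      by (simp add: c_def nrm_def inner_simps axes)
  next
    case 5
    then show ?thesis using e[of True True False] e[of True False False] e[of False True False]
      by (simp add: c_def nrm_def inner_simps axes)
  next
    case 6
    then show ?thesis using e[of True True True] e[of True False True] e[of False True True]
      by (simp add: c_def nrm_def inner_simps axes)
  qed
  then have "x = c *\<^sub>R nrm m"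
    by (intro eqI) (simp_all add: R0 R_nrm)
  then show "x \<in> span {nrm m}" by (metis insertI1 span_base span_mul)
qed

section \<open>Faces of the iterated pyramid over the dual with a chosen set of apexes\<close>

context
  fixes S :: "'a set"
  assumes S: "S \<subseteq> R"
begin

text \<open>Killing the coordinates in \<open>R - S\<close> retains only the apexes in
  \<open>S\<close>: \<open>pyr\<close> is the iterated pyramid with these apexes, \<open>apx\<close>
  the simplex they span, and \<open>side p\<close> the pyramid over the facet of the dual belonging
  to \<open>pt p\<close>. With \<open>card S = k - 2\<close> they serve as \<open>Y\<close>,
  \<open>Z\<close> and \<open>X p\<close> of \<open>not_weakly_k_scribed\<close>.\<close>

definition pyr where "pyr = ineq_face A2 (R - S)"
definition apx where "apx = ineq_face A2 (range pt \<union> (R - S))"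
definition side where "side p = ineq_face A2 (insert (pt p) (R - S))"

lemma dual_faces: "pyr \<in> spherical_faces dual.cone_polytope" "apx \<in> spherical_faces dual.cone_polytope"
  "side p \<in> spherical_faces dual.cone_polytope"
  unfolding pyr_def apx_def side_def
  by (intro dual.ineq_face_in_faces; auto simp: A2_def)+

lemma dual_faces_subset: "apx \<subseteq> pyr" "apx \<subseteq> side p" "side p \<subseteq> pyr"
  by (auto simp: pyr_def apx_def side_def ineq_face_def)

lemma S_props:
  assumes "b \<in> S"
  shows "norm b = 1" "b \<in> ineq_cone A2" "pt p \<bullet> b = 0" "a \<in> R - S \<Longrightarrow> a \<bullet> b = 0"
proof -
  have b: "b \<in> R" using assms S by blast
  show "norm b = 1" using b R by simp
  show pt: "pt p \<bullet> b = 0" for p using R_pt[OF b, of p] by (simp only: inner_commute)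
  show "a \<bullet> b = 0" if "a \<in> R - S" using R_inner[of a b] that b assms by auto
  have "0 \<le> a \<bullet> b" if "a \<in> R" for a using R_inner[OF that b] by simp
  then show "b \<in> ineq_cone A2" by (auto simp: ineq_cone_def A2_def pt)
qed

lemma S_apx: "S \<subseteq> apx"
proof
  fix b assume b: "b \<in> S"
  show "b \<in> apx"
    unfolding apx_def ineq_face_def
  proof (intro IntI CollectI conjI ballI)
    show "b \<in> sphere 0 1" using S_props(1)[OF b] by simp
    show "a \<bullet> b = 0" if "a \<in> range pt \<union> (R - S)" for a
      using that S_props(3,4)[OF b] by blast
  qed (rule S_props(2)[OF b])
qed

lemma axes_pyr: "{\<tau>, \<xi>, \<eta>, \<zeta>} \<union> S \<subseteq> pyr"
proof -
  have "a \<in> pyr" if a: "a \<in> {\<tau>, \<xi>, \<eta>, \<zeta>}" for a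
  proof -
    have "a \<in> Basis" using a Basis by blast
    then have "norm a = 1" by simp
    moreover have R0: "b \<bullet> a = 0" if "b \<in> R" for b using a axes_R[OF that] by blast
    moreover have "0 \<le> pt p \<bullet> a" for p using a pt_axes[of p] zero_le_one by (metis insertE singletonD)
    ultimately show ?thesis
      by (auto simp: pyr_def ineq_face_def ineq_cone_def A2_def)
  qed
  then show ?thesis using S_apx dual_faces_subset(1) by blast
qed

lemma indep: "independent ({\<tau>, \<xi>, \<eta>, \<zeta>} \<union> S)"
  using Basis S R by (intro independent_mono[OF independent_Basis]) auto

lemma pyr_subset: "pyr \<subseteq> span ({\<tau>, \<xi>, \<eta>, \<zeta>} \<union> S)"
proof
  fix x assume "x \<in> pyr"
  then have x: "b \<bullet> x = 0" if "b \<in> R - S" for b using that by (auto simp: pyr_def ineq_face_def)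
  have "(\<Sum>b\<in>Basis. (x \<bullet> b) *\<^sub>R b) \<in> span ({\<tau>, \<xi>, \<eta>, \<zeta>} \<union> S)"
  proof (rule span_sum)
    fix b :: 'a assume "b \<in> Basis"
    then consider "b \<in> R - S" | "b \<in> {\<tau>, \<xi>, \<eta>, \<zeta>} \<union> S" using R by blast
    then show "(x \<bullet> b) *\<^sub>R b \<in> span ({\<tau>, \<xi>, \<eta>, \<zeta>} \<union> S)"
    proof cases
      case 1
      then show ?thesis using x by (simp add: inner_commute span_zero)
    next
      case 2
      then show ?thesis by (intro span_mul span_base)
    qed
  qed
  then show "x \<in> span ({\<tau>, \<xi>, \<eta>, \<zeta>} \<union> S)" by (simp add: euclidean_representation)
qed

lemma dim_pyr: "dim pyr = card S + 4"
proof -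
  have "dim pyr = dim ({\<tau>, \<xi>, \<eta>, \<zeta>} \<union> S)"
    using axes_pyr pyr_subset by (metis dim_subset dim_span antisym)
  also have "\<dots> = card ({\<tau>, \<xi>, \<eta>, \<zeta>} \<union> S)" by (rule dim_eq_card_independent[OF indep])
  also have "\<dots> = card {\<tau>, \<xi>, \<eta>, \<zeta>} + card S"
    using S R fin_R by (intro card_Un_disjoint) (auto intro: finite_subset)
  also have "card {\<tau>, \<xi>, \<eta>, \<zeta>} = 4" using distinct by simp
  finally show ?thesis by simp
qed

lemma dim_apx: "card S \<le> dim apx"
proof -
  have "independent S" by (rule independent_mono[OF indep]) blast
  then have "card S = dim S" by (simp add: dim_eq_card_independent)
  also have "\<dots> \<le> dim apx" by (rule dim_subset[OF S_apx])
  finally show ?thesis .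
qed

text \<open>Since \<open>pt p \<bullet> \<tau> = 1\<close>, the face is proper in
  \<open>pyr\<close>. Conversely it contains a multiple of one normal from each opposite pair, or of
  \<open>nrm 6\<close> at the moved corner; together with \<open>\<tau>\<close> these yield all four
  axes, so adding \<open>\<tau>\<close> spans \<open>pyr\<close>.\<close>

lemma dim_side: "dim (side p) = card S + 3"
proof (rule antisym)
  have "\<tau> \<in> pyr" using axes_pyr by blast
  moreover have "\<tau> \<notin> side p" using pt_axes(1)[of p] by (auto simp: side_def ineq_face_def)
  ultimately have "side p \<subset> pyr" using dual_faces_subset(3) by blast
  then have "dim (side p) < dim pyr"
    by (rule dim_spherical_face_less[OF dual.spherical_polytope_cone_polytope dual_faces(3,1)])
  then show "dim (side p) \<le> card S + 3" by (simp add: dim_pyr)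
  define W where "W = span (insert \<tau> (side p))"
  have W: "subspace W" by (simp add: W_def)
  have side: "v \<in> W" if "v \<noteq> 0" "v \<in> ineq_cone A2" "pt p \<bullet> v = 0" "\<And>b. b \<in> R - S \<Longrightarrow> b \<bullet> v = 0" for v
  proof -
    have "sgn v \<in> side p"
      unfolding side_def using that by (subst dual.sgn_in_ineq_face) auto
    then have "norm v *\<^sub>R sgn v \<in> W" unfolding W_def by (intro span_mul span_base) simp
    then show ?thesis using that(1) by (simp add: sgn_div_norm)
  qed
  have nW: "nrm m \<in> W" if "m \<le> 6" "pt p \<bullet> nrm m = 0" for m
    by (rule side) (use that nrm_nz nrm_in_cone R_nrm in auto)
  have \<tau>W: "\<tau> \<in> W" unfolding W_def by (simp add: span_base)
  have or: "\<And>m. m \<in> {0, 2} \<Longrightarrow> pt p \<bullet> nrm m = 0 \<or> pt p \<bullet> nrm (m + 1) = 0"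
    "pt p \<bullet> nrm 4 = 0 \<or> pt p \<bullet> nrm 5 = 0 \<or> p = (False, False, False) \<and> pt p \<bullet> nrm 6 = 0"
    by (cases p; auto simp: pt_inner Let_def)+
  have \<xi>W: "\<xi> \<in> W"
  proof -
    have "\<xi> \<in> W \<or> \<tau> - \<xi> \<in> W" using or(1)[of 0] nW[of 0] nW[of 1] by (auto simp: nrm_def)
    then show ?thesis using subspace_diff[OF W \<tau>W, of "\<tau> - \<xi>"] by auto
  qed
  have \<eta>W: "\<eta> \<in> W"
  proof -
    have "\<eta> \<in> W \<or> \<tau> - \<eta> \<in> W" using or(1)[of 2] nW[of 2] nW[of 3] by (auto simp: nrm_def)
    then show ?thesis using subspace_diff[OF W \<tau>W, of "\<tau> - \<eta>"] by auto
  qed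
  have \<zeta>W: "\<zeta> \<in> W"
  proof -
    consider "\<zeta> \<in> W" | "\<tau> - \<zeta> \<in> W" | "\<xi> + \<eta> + 2 *\<^sub>R \<zeta> - \<tau> \<in> W"
      using or(2) nW[of 4] nW[of 5] nW[of 6] by (auto simp: nrm_def)
    then show ?thesis
    proof cases
      case 2
      then show ?thesis using subspace_diff[OF W \<tau>W, of "\<tau> - \<zeta>"] by auto
    next
      case 3
      have "\<zeta> = (1/2) *\<^sub>R ((\<xi> + \<eta> + 2 *\<^sub>R \<zeta> - \<tau>) + \<tau> - \<xi> - \<eta>)" by (simp add: algebra_simps)
      also have "\<dots> \<in> W"
        by (intro subspace_mul subspace_diff subspace_add W 3 \<tau>W \<xi>W \<eta>W)
      finally show ?thesis .
    qed
  qed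
  have SW: "b \<in> W" if "b \<in> S" for b
    by (rule side) (use that S_props[of b] in auto)
  have "{\<tau>, \<xi>, \<eta>, \<zeta>} \<union> S \<subseteq> W" using \<tau>W \<xi>W \<eta>W \<zeta>W SW by blast
  then have "pyr \<subseteq> W" using pyr_subset span_minimal[OF _ W] by blast
  then have "dim pyr \<le> dim (insert \<tau> (side p))" unfolding W_def by (metis dim_span dim_subset)
  then show "card S + 3 \<le> dim (side p)" by (simp add: dim_pyr dim_insert split: if_splits)
qed

lemma nrm_pyr: "sgn (nrm m) \<in> pyr"
  unfolding pyr_def using R_nrm nrm_nz nrm_in_cone by (subst dual.sgn_in_ineq_face) auto

lemma nrm_side: "m < 6 \<Longrightarrow> sgn (nrm m) \<in> side p \<longleftrightarrow> incident m p"
  unfolding side_def using R_nrm nrm_nz nrm_in_cone pt_nrm(2)[of m p]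
  by (subst dual.sgn_in_ineq_face) auto

end

end

section \<open>A polytope with complete graph\<close>

text \<open>The direct sum of a triangle and a simplex: its generators are the coordinate axes and one
  further vector \<open>apex\<close>, and the only linear relation says that a multiple of \<open>apex\<close> plus the sum
  of the axes in \<open>J\<close> equals the sum of the three axes in \<open>I\<close>.\<close>

locale triangle_axes =
  fixes I J :: "'a::euclidean_space set"
  assumes I: "I \<subseteq> Basis" "card I = 3" and J: "J = Basis - I" and card_J: "2 \<le> card J"
begin

text \<open>These inequalities describe the cone generated by the axes and
  \<open>\<Sum>I - \<Sum>J\<close>: if \<open>t\<close> is the maximum of 0 and the negated
  \<open>J\<close>-coordinates of \<open>x\<close>, subtracting \<open>t\<close> times that vector
  leaves only nonnegative coordinates.\<close>

definition A1 :: "'a set" where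
  "A1 = I \<union> {i + j | i j. i \<in> I \<and> j \<in> J}"

definition apex :: 'a where
  "apex = sgn (\<Sum>I - \<Sum>J)"

definition gens :: "'a set" where
  "gens = insert apex Basis"

lemma fin: "finite I" "finite J"
  using I J by (auto intro: finite_subset)

lemma Basis_eq: "Basis = I \<union> J" "I \<inter> J = {}"
  using I J by auto

lemma mem_Basis: "i \<in> I \<Longrightarrow> i \<in> Basis" "j \<in> J \<Longrightarrow> j \<in> Basis" "i \<in> I \<Longrightarrow> j \<in> J \<Longrightarrow> i \<noteq> j"
  "i \<in> I \<Longrightarrow> j \<in> J \<Longrightarrow> j \<noteq> i"
  using I J by auto

lemma card_le_2: "card {a, b} \<le> 2" "finite {a, b}"
  by (simp_all add: card_insert_if)

lemma inner_basis: "a \<in> Basis \<Longrightarrow> b \<in> Basis \<Longrightarrow> a \<bullet> b = (if a = b then 1 else 0)"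
  by (simp add: inner_Basis)

lemma inner_apex: obtains c where "0 < c" "\<And>i. i \<in> I \<Longrightarrow> i \<bullet> apex = c" "\<And>j. j \<in> J \<Longrightarrow> j \<bullet> apex = - c"
proof -
  have i: "i \<bullet> (\<Sum>I - \<Sum>J) = 1" if "i \<in> I" for i
  proof -
    have "i \<bullet> \<Sum>I = (\<Sum>a\<in>I. if i = a then 1 else 0)" "i \<bullet> \<Sum>J = (\<Sum>a\<in>J. 0)"
      unfolding inner_sum_right using that by (auto intro!: sum.cong simp: inner_basis mem_Basis)
    then show ?thesis using that fin by (simp add: inner_diff_right)
  qed
  have j: "j \<bullet> (\<Sum>I - \<Sum>J) = - 1" if "j \<in> J" for j
  proof -
    have "j \<bullet> \<Sum>J = (\<Sum>a\<in>J. if j = a then 1 else 0)" "j \<bullet> \<Sum>I = (\<Sum>a\<in>I. 0)"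
      unfolding inner_sum_right using that by (auto intro!: sum.cong simp: inner_basis mem_Basis)
    then show ?thesis using that fin by (simp add: inner_diff_right)
  qed
  have "I \<noteq> {}" using I(2) by auto
  then have "\<Sum>I - \<Sum>J \<noteq> 0" using i by fastforce
  then have "0 < 1 / norm (\<Sum>I - \<Sum>J)" by simp
  then show thesis
    by (rule that) (simp_all add: apex_def sgn_div_norm i j inverse_eq_divide)
qed

lemma inner_apex_nz: "b \<in> Basis \<Longrightarrow> b \<bullet> apex \<noteq> 0"
  using inner_apex Basis_eq(1) by (metis UnE less_irrefl neg_0_equal_iff_equal)

lemma large_Basis: "finite S \<Longrightarrow> card S \<le> 2 \<Longrightarrow> \<exists>b\<in>Basis. b \<notin> S"
  "card S \<le> 2 \<Longrightarrow> finite S \<Longrightarrow> \<exists>i\<in>I. i \<notin> S" "\<exists>j\<in>J. j \<noteq> p"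
proof -
  show i: "\<exists>i\<in>I. i \<notin> S" if "card S \<le> 2" "finite S" for S :: "'a set"
    using card_mono[OF that(2), of I] that(1) I(2) by fastforce
  show "\<exists>b\<in>Basis. b \<notin> S" if "finite S" "card S \<le> 2" for S :: "'a set"
    using i[OF that(2,1)] I by blast
  show "\<exists>j\<in>J. j \<noteq> p"
    using card_mono[of "{p}" J] card_J by fastforce
qed

lemma gens_nz: "p \<in> gens \<Longrightarrow> p \<noteq> 0" "p \<in> gens \<Longrightarrow> norm p = 1" "p \<in> gens \<Longrightarrow> sgn p = p"
proof -
  have "\<Sum>I - \<Sum>J \<noteq> 0"
  proof
    assume "\<Sum>I - \<Sum>J = 0"
    then have "apex = 0" by (simp add: apex_def)
    then show False using inner_apex_nz[OF SOME_Basis] by simp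
  qed
  then have "norm apex = 1" by (simp add: apex_def norm_sgn)
  then show n: "norm p = 1" if "p \<in> gens" for p using that by (auto simp: gens_def)
  show "p \<noteq> 0" "sgn p = p" if "p \<in> gens" for p
    using n[OF that] by (auto simp: sgn_div_norm)
qed

lemma gens_independent:
  assumes pqr: "p \<in> gens" "q \<in> gens" "r \<in> gens" "r \<noteq> p" "r \<noteq> q" "p \<noteq> q"
  shows "r \<notin> span {p, q}"
proof
  assume "r \<in> span {p, q}"
  then obtain \<alpha> \<beta> where r: "r = \<alpha> *\<^sub>R p + \<beta> *\<^sub>R q"
    by (rule span_pairE)
  have inner: "b \<bullet> r = \<alpha> * (b \<bullet> p) + \<beta> * (b \<bullet> q)" for b by (simp add: r inner_simps)
  have small: "card {a, b} \<le> 2" for a b :: 'a by (simp add: card_insert_if)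
  consider "p \<in> Basis" "q \<in> Basis" "r \<in> Basis" | "p \<in> Basis" "q \<in> Basis" "r = apex"
    | "p = apex" "q \<in> Basis" "r \<in> Basis" | "p \<in> Basis" "q = apex" "r \<in> Basis"
    using pqr by (auto simp: gens_def)
  then show False
  proof cases
    case 1
    then show ?thesis using inner[of r] pqr by (simp add: inner_basis)
  next
    case 2
    obtain b where "b \<in> Basis" "b \<notin> {p, q}" using large_Basis(1)[of "{p, q}"] small by auto
    then show ?thesis using inner[of b] 2 inner_apex_nz[of b] by (simp add: inner_basis)
  next
    case 3
    obtain b where "b \<in> Basis" "b \<notin> {q, r}" using large_Basis(1)[of "{q, r}"] small by auto
    then have "\<alpha> = 0" using inner[of b] 3 inner_apex_nz[of b] by (simp add: inner_basis)
    then show ?thesis using inner[of r] 3 pqr by (simp add: inner_basis)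
  next
    case 4
    obtain b where "b \<in> Basis" "b \<notin> {p, r}" using large_Basis(1)[of "{p, r}"] small by auto
    then have "\<beta> = 0" using inner[of b] 4 inner_apex_nz[of b] by (simp add: inner_basis)
    then show ?thesis using inner[of r] 4 pqr by (simp add: inner_basis)
  qed
qed

lemma apex_notin_Basis: "apex \<notin> Basis"
proof
  assume a: "apex \<in> Basis"
  obtain b where "b \<in> Basis" "b \<notin> {apex}" using large_Basis(1)[of "{apex}"] by auto
  then show False using inner_apex_nz[of b] a by (simp add: inner_basis)
qed

lemma card_gens: "finite gens" "card gens = Suc DIM('a)"
  using apex_notin_Basis by (simp_all add: gens_def)

sublocale sum: pointed_ineq_cone A1
proof
  have "A1 = I \<union> (\<lambda>(i, j). i + j) ` (I \<times> J)" by (auto simp: A1_def)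
  then show "finite A1" using fin by simp
  have "i + j \<noteq> 0" if "i \<in> I" "j \<in> J" for i j
  proof
    assume "i + j = 0"
    then have "i \<bullet> (i + j) = 0" by simp
    moreover have "i \<bullet> i = 1" "i \<bullet> j = 0" using that by (simp_all add: inner_basis mem_Basis)
    ultimately show False by (simp add: inner_add_right)
  qed
  moreover have "0 \<notin> I" using I by auto
  ultimately show "0 \<notin> A1" by (auto simp: A1_def)
next
  fix x assume x: "\<And>a. a \<in> A1 \<Longrightarrow> a \<bullet> x = 0"
  have i: "i \<bullet> x = 0" if "i \<in> I" for i using x that by (auto simp: A1_def)
  obtain i where "i \<in> I" using I(2) by fastforce
  have j: "j \<bullet> x = 0" if "j \<in> J" for j
    using x[of "i + j"] i[OF \<open>i \<in> I\<close>] that \<open>i \<in> I\<close> by (auto simp: A1_def inner_add_left)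
  show "x = 0"
  proof (rule euclidean_eqI)
    fix b :: 'a assume "b \<in> Basis"
    then have "b \<bullet> x = 0" using i j Basis_eq(1) by blast
    then show "x \<bullet> b = 0 \<bullet> b" by (simp add: inner_commute)
  qed
next
  have "0 < b \<bullet> \<Sum>Basis" if "b \<in> Basis" for b :: 'a
    using that by (simp add: inner_sum_right inner_Basis)
  then have "0 < a \<bullet> \<Sum>Basis" if "a \<in> A1" for a
    using that by (auto simp: A1_def inner_add_left mem_Basis intro!: add_pos_pos)
  then show "\<exists>x. \<forall>a\<in>A1. 0 < a \<bullet> x" by blast
qed

lemma gens_in_cone: "p \<in> gens \<Longrightarrow> p \<in> ineq_cone A1"
proof -
  assume p: "p \<in> gens"
  obtain c where c: "0 < c" "\<And>i. i \<in> I \<Longrightarrow> i \<bullet> apex = c" "\<And>j. j \<in> J \<Longrightarrow> j \<bullet> apex = - c"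
    by (rule inner_apex) blast
  have "0 \<le> a \<bullet> p" if "a \<in> Basis" "p \<noteq> apex" for a
    using that p inner_basis[of a p] by (auto simp: gens_def)
  then show ?thesis
    using c by (cases "p = apex")
      (auto simp: ineq_cone_def A1_def inner_add_left mem_Basis intro!: add_nonneg_nonneg)
qed

text \<open>The minimal non-faces are \<open>I\<close> and \<open>J\<close> together with
  \<open>apex\<close>. Both have at least three elements, so every pair of generators spans an edge:
  some indices in \<open>I\<close> and \<open>J\<close> always remain to carry the
  equations.\<close>

lemma edge_span:
  assumes pq: "p \<in> gens" "q \<in> gens" "p \<noteq> q"
    and x: "\<And>a. a \<in> A1 \<Longrightarrow> a \<bullet> p = 0 \<Longrightarrow> a \<bullet> q = 0 \<Longrightarrow> a \<bullet> x = 0"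
  shows "x \<in> span {p, q}"
proof -
  have i: "i \<bullet> p = 0 \<Longrightarrow> i \<bullet> q = 0 \<Longrightarrow> i \<bullet> x = 0" if "i \<in> I" for i
    using x[of i] that by (auto simp: A1_def)
  have ij: "i \<bullet> p + j \<bullet> p = 0 \<Longrightarrow> i \<bullet> q + j \<bullet> q = 0 \<Longrightarrow> i \<bullet> x + j \<bullet> x = 0"
    if "i \<in> I" "j \<in> J" for i j
    using x[of "i + j"] that by (auto simp: A1_def inner_add_left)
  have apex: "x \<in> span {p, apex}"
    if p: "p \<in> Basis" and ij: "\<And>i j. i \<in> I \<Longrightarrow> j \<in> J \<Longrightarrow> i \<noteq> p \<Longrightarrow> j \<noteq> p \<Longrightarrow> i \<bullet> x + j \<bullet> x = 0" for p
  proof -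
    obtain c where c: "0 < c" "\<And>i. i \<in> I \<Longrightarrow> i \<bullet> apex = c" "\<And>j. j \<in> J \<Longrightarrow> j \<bullet> apex = - c"
      by (rule inner_apex) blast
    obtain i0 where i0: "i0 \<in> I" "i0 \<noteq> p" using large_Basis(2)[of "{p}"] by auto
    obtain j0 where j0: "j0 \<in> J" "j0 \<noteq> p" using large_Basis(3) by blast
    \<comment> \<open>The equations make \<open>x\<close> constant on \<open>I\<close> and opposite
      on \<open>J\<close>, away from \<open>p\<close>; \<open>m\<close> is the resulting coefficient
      of \<open>apex\<close>.\<close>
    define m where "m = (i0 \<bullet> x) / c"
    have j: "j \<bullet> x = - (m * c)" if "j \<in> J" "j \<noteq> p" for j
      using ij[OF i0(1) that(1) i0(2) that(2)] c(1) by (simp add: m_def)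
    have i: "i \<bullet> x = m * c" if "i \<in> I" "i \<noteq> p" for i
      using ij[OF that(1) j0(1) that(2) j0(2)] j[OF j0] by simp
    have "x = m *\<^sub>R apex + (p \<bullet> x - m * (p \<bullet> apex)) *\<^sub>R p"
    proof (rule euclidean_eqI)
      fix b :: 'a assume b: "b \<in> Basis"
      have "b \<bullet> x = b \<bullet> (m *\<^sub>R apex + (p \<bullet> x - m * (p \<bullet> apex)) *\<^sub>R p)"
      proof (cases "b = p")
        case True
        then show ?thesis using p by (simp add: inner_simps)
      next
        case False
        then show ?thesis
          using b p i[of b] j[of b] c(2,3)[of b] Basis_eq(1) UnE[of b I J]
          by (simp add: inner_add_right inner_diff_right inner_basis) (metis mult_minus_right)
      qed
      then show "x \<bullet> b = (m *\<^sub>R apex + (p \<bullet> x - m * (p \<bullet> apex)) *\<^sub>R p) \<bullet> b"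
        by (simp only: inner_commute)
    qed
    then show ?thesis by (metis insertI1 insertI2 span_add span_base span_mul)
  qed
  have apex_ij: "i \<bullet> apex + j \<bullet> apex = 0" if "i \<in> I" "j \<in> J" for i j
    using that by (rule_tac inner_apex) auto
  consider "p \<in> Basis" "q \<in> Basis" | "p \<in> Basis" "q = apex" | "p = apex" "q \<in> Basis"
    using pq by (auto simp: gens_def)
  then show ?thesis
  proof cases
    case 1
    have Iz: "b \<bullet> x = 0" if "b \<in> I" "b \<noteq> p" "b \<noteq> q" for b
      using i[OF that(1)] that 1 I(1) by (auto simp: inner_basis)
    have Jz: "b \<bullet> x = 0" if b: "b \<in> J" "b \<noteq> p" "b \<noteq> q" for b
    proof -
      obtain i where "i \<in> I" "i \<notin> {p, q}"
        using large_Basis(2)[OF card_le_2] by blast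
      then show ?thesis
        using ij[of i b] Iz[of i] b 1 by (simp add: inner_basis mem_Basis)
    qed
    have "(\<Sum>b\<in>Basis. (x \<bullet> b) *\<^sub>R b) \<in> span {p, q}"
    proof (rule span_sum)
      fix b :: 'a assume "b \<in> Basis"
      then have "b \<in> {p, q} \<or> x \<bullet> b = 0"
        using Iz[of b] Jz[of b] Basis_eq(1) by (auto simp: inner_commute)
      then show "(x \<bullet> b) *\<^sub>R b \<in> span {p, q}"
        by (metis scaleR_zero_left span_base span_mul span_zero)
    qed
    then show ?thesis by (simp add: euclidean_representation)
  next
    case 2
    show ?thesis unfolding 2(2)
    proof (rule apex[OF 2(1)])
      fix i j assume "i \<in> I" "j \<in> J" "i \<noteq> p" "j \<noteq> p"
      then show "i \<bullet> x + j \<bullet> x = 0"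
        using ij[of i j] apex_ij[of i j] 2 by (simp add: inner_basis mem_Basis)
    qed
  next
    case 3
    have "x \<in> span {q, apex}"
    proof (rule apex[OF 3(2)])
      fix i j assume "i \<in> I" "j \<in> J" "i \<noteq> q" "j \<noteq> q"
      then show "i \<bullet> x + j \<bullet> x = 0"
        using ij[of i j] apex_ij[of i j] 3 by (simp add: inner_basis mem_Basis)
    qed
    then show ?thesis by (simp add: 3(1) insert_commute)
  qed
qed

lemma gens_vertex:
  assumes p: "p \<in> gens"
  shows "{p} \<in> spherical_faces sum.cone_polytope"
proof -
  \<comment> \<open>The vertex is obtained as the intersection of two edges through it.\<close>
  have "\<exists>q r. q \<in> gens \<and> r \<in> gens \<and> distinct [p, q, r]"
  proof -
    obtain q where q: "q \<in> Basis" "q \<notin> {p}" using large_Basis(1)[of "{p}"] by auto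
    obtain r where r: "r \<in> Basis" "r \<notin> {p, q}"
      using large_Basis(1)[OF card_le_2(2,1)] by blast
    show ?thesis using q r by (intro exI[of _ q] exI[of _ r]) (auto simp: gens_def)
  qed
  then obtain q r where qr: "q \<in> gens" "r \<in> gens" "p \<noteq> q" "p \<noteq> r" "q \<noteq> r" by auto
  have "{sgn p} \<in> spherical_faces sum.cone_polytope"
  proof (rule sum.vertexI[OF gens_nz(1)[OF p] gens_in_cone[OF p]])
    let ?B = "{a \<in> A1. a \<bullet> p = 0}"
    show "?B \<subseteq> A1" by blast
    show "a \<bullet> p = 0" if "a \<in> ?B" for a using that by blast
    fix x assume x: "\<And>a. a \<in> ?B \<Longrightarrow> a \<bullet> x = 0"
    have "x \<in> span {p, q}" "x \<in> span {p, r}"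
      using x by (auto intro!: edge_span p qr)
    then obtain \<alpha> \<beta> \<gamma> \<delta> where x: "x = \<alpha> *\<^sub>R p + \<beta> *\<^sub>R q" "x = \<gamma> *\<^sub>R p + \<delta> *\<^sub>R r"
      by (metis span_pairE)
    have "\<delta> *\<^sub>R r = x - \<gamma> *\<^sub>R p" by (simp add: x(2))
    then have "\<delta> *\<^sub>R r = (\<alpha> - \<gamma>) *\<^sub>R p + \<beta> *\<^sub>R q" by (simp add: x(1) algebra_simps)
    then have "\<delta> *\<^sub>R r \<in> span {p, q}" by (metis insertI1 insertI2 span_add span_base span_mul)
    then have "\<delta> = 0"
      using gens_independent[OF p qr(1,2)] qr span_mul[of "\<delta> *\<^sub>R r" "{p, q}" "1 / \<delta>"]
      by (cases "\<delta> = 0") auto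
    then show "x \<in> span {p}"
      using x(2) by (simp add: span_mul span_base)
  qed
  then show ?thesis by (simp add: gens_nz p)
qed

definition edge :: "'a \<Rightarrow> 'a \<Rightarrow> 'a set" where
  "edge p q = ineq_face A1 {a \<in> A1. a \<bullet> p = 0 \<and> a \<bullet> q = 0}"

lemma edge_face: "edge p q \<in> spherical_faces sum.cone_polytope"
  unfolding edge_def by (rule sum.ineq_face_in_faces) blast

lemma edge_props:
  assumes pq: "p \<in> gens" "q \<in> gens" "p \<noteq> q"
  shows "dim (edge p q) = 2" "edge p q \<inter> gens = {p, q}"
proof -
  have sub: "edge p q \<subseteq> span {p, q}"
    using edge_span[OF pq] by (auto simp: edge_def ineq_face_def)
  have sup: "{p, q} \<subseteq> edge p q"
    using gens_in_cone gens_nz(2) pq by (auto simp: edge_def ineq_face_def)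
  show "edge p q \<inter> gens = {p, q}"
    using sub sup pq gens_independent[of p q] by blast
  have "dim (edge p q) = dim {p, q}"
    using sub sup by (metis dim_subset dim_span antisym)
  also have "\<dots> = card {p, q}"
  proof (rule dim_eq_card_independent, rule independent_insertI[OF _ independent_insertI[OF _ independent_empty]])
    show "p \<notin> span {q}"
    proof
      assume "p \<in> span {q}"
      then obtain c where c: "p = c *\<^sub>R q" by (auto simp: span_singleton)
      obtain b where b: "b \<in> Basis" "b \<notin> {p, q}"
        using large_Basis(1)[OF card_le_2(2,1)] by blast
      have "p \<in> span {q, b}" unfolding c by (intro span_mul span_base) simp
      then show False using gens_independent[of q b p] b pq by (auto simp: gens_def)
    qed
    show "q \<notin> span {}" using gens_nz(1)[OF pq(2)] by simp
  qed
  also have "\<dots> = 2" using pq by simp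
  finally show "dim (edge p q) = 2" .
qed

end

section \<open>Non-scribable polytopes\<close>

lemma four_axes_exist:
  assumes "4 \<le> DIM('a::euclidean_space)"
  obtains \<tau> \<xi> \<eta> \<zeta> :: "'a::euclidean_space" where "four_axes \<tau> \<xi> \<eta> \<zeta> (Basis - {\<tau>, \<xi>, \<eta>, \<zeta>})"
proof -
  obtain T :: "'a set" where T: "T \<subseteq> Basis" "card T = 4"
    using assms by (rule obtain_subset_with_card_n)
  obtain xs where xs: "set xs = T" "distinct xs" 
    using finite_distinct_list[of T] T card_ge_0_finite[of T] by auto
  then have "length xs = 4" using T(2) distinct_card by fastforce
  then obtain \<tau> \<xi> \<eta> \<zeta> where "xs = [\<tau>, \<xi>, \<eta>, \<zeta>]"
    by (auto simp: numeral_eq_Suc length_Suc_conv)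
  then show thesis
    using xs T by (intro that[of \<tau> \<xi> \<eta> \<zeta>] four_axes.intro) auto
qed

lemma not_weakly_scribable_0:
  assumes "3 \<le> CARD('n::finite)"
  shows "\<exists>P :: (real \<times> (real^'n)) set. spherical_d_polytope CARD('n) P \<and> \<not> weakly_scribable 0 P"
proof -
  have "4 \<le> DIM(real \<times> (real^'n))" using assms by simp
  then obtain \<tau> \<xi> \<eta> \<zeta> :: "real \<times> (real^'n)"
    where "four_axes \<tau> \<xi> \<eta> \<zeta> (Basis - {\<tau>, \<xi>, \<eta>, \<zeta>})"
    by (rule four_axes_exist)
  then interpret four_axes \<tau> \<xi> \<eta> \<zeta> "Basis - {\<tau>, \<xi>, \<eta>, \<zeta>}" .
  show ?thesis
  proof (intro exI conjI notI)
    show "spherical_d_polytope CARD('n) broken_cube.cone_polytope"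
      by (rule broken_cube.spherical_d_polytope_cone_polytope) simp
    assume "weakly_scribable 0 broken_cube.cone_polytope"
    then obtain Q :: "(real \<times> (real^'n)) set" where Q: "spherical_polytope Q" 
      "combinatorially_equivalent broken_cube.cone_polytope Q" "weakly_scribed 0 Q"
      by (auto simp: weakly_scribable_def spherical_d_polytope_def)
    from Q(2) broken_cube.spherical_polytope_cone_polytope Q(1) obtain f g where fg:
      "\<And>X. X \<in> spherical_faces broken_cube.cone_polytope \<Longrightarrow> f X \<in> spherical_faces Q"
      "\<And>X Y. X \<in> spherical_faces broken_cube.cone_polytope \<Longrightarrow> Y \<in> spherical_faces broken_cube.cone_polytope
        \<Longrightarrow> f X \<subseteq> f Y \<longleftrightarrow> X \<subseteq> Y"
      "\<And>X. X \<in> spherical_faces broken_cube.cone_polytope \<Longrightarrow> dim (f X) = dim X"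
      "\<And>p. {p} \<in> spherical_faces broken_cube.cone_polytope \<Longrightarrow> {g p} \<in> spherical_faces Q"
      "\<And>p X. {p} \<in> spherical_faces broken_cube.cone_polytope \<Longrightarrow> X \<in> spherical_faces broken_cube.cone_polytope
        \<Longrightarrow> g p \<in> f X \<longleftrightarrow> p \<in> X"
      by (rule combinatorially_equivalent_verticesE) blast
    let ?Y = "ineq_face A0 (Basis - {\<tau>, \<xi>, \<eta>, \<zeta>})"
    show False
    proof (rule not_weakly_0_scribed[OF Q(1,3), of "f ?Y" "\<lambda>p. g (sgn (pt p))" "\<lambda>m. f (ineq_face A0 {nrm m})"])
      show "f ?Y \<in> spherical_faces Q" by (intro fg broken_cube_faces)
      show "dim (f ?Y) \<le> 4" using fg(3)[OF broken_cube_faces(2)] dim_base by simp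
      show "{g (sgn (pt p))} \<in> spherical_faces Q" for p by (intro fg pt_vertex)
      show "g (sgn (pt p)) \<in> f ?Y" for p
        using fg(5)[OF pt_vertex broken_cube_faces(2)] R_pt
          broken_cube.sgn_in_ineq_face[OF pt_nz pt_in_cone] by blast
      show "f (ineq_face A0 {nrm m}) \<in> spherical_faces Q" if "m < 6" for m
        using that by (intro fg broken_cube_faces)
      show "g (sgn (pt p)) \<in> f (ineq_face A0 {nrm m}) \<longleftrightarrow> incident m p" if "m < 6" for m p
        using fg(5)[OF pt_vertex broken_cube_faces(1)[OF that]] pt_nrm(2)[OF that, of p]
          broken_cube.sgn_in_ineq_face[OF pt_nz pt_in_cone, of p "{nrm m}"]
        by (simp add: inner_commute)
    qed
  qed
qed

lemma not_weakly_scribable_1: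
  assumes "4 \<le> CARD('n::finite)"
  shows "\<exists>P :: (real \<times> (real^'n)) set. spherical_d_polytope CARD('n) P \<and> \<not> weakly_scribable 1 P"
proof -
  have "3 \<le> card (Basis :: (real \<times> (real^'n)) set)" using assms by simp
  then obtain T :: "(real \<times> (real^'n)) set" where T: "T \<subseteq> Basis" "card T = 3"
    by (rule obtain_subset_with_card_n)
  \<comment> \<open>The bound \<open>2 \<le> card J\<close> amounts to
    \<open>d + 1 - 3 \<ge> 2\<close>, that is \<open>d \<ge> 4\<close>.\<close>
  have "card (Basis - T) = Suc CARD('n) - 3"
    using T by (subst card_Diff_subset) (auto intro: finite_subset)
  then interpret triangle_axes T "Basis - T"
    using T assms by unfold_locales auto
  show ?thesis
  proof (intro exI conjI notI)
    show "spherical_d_polytope CARD('n) sum.cone_polytope"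
      by (rule sum.spherical_d_polytope_cone_polytope) simp
    assume "weakly_scribable 1 sum.cone_polytope"
    then obtain Q :: "(real \<times> (real^'n)) set" where Q: "spherical_polytope Q" 
      "combinatorially_equivalent sum.cone_polytope Q" "weakly_scribed 1 Q"
      by (auto simp: weakly_scribable_def spherical_d_polytope_def)
    from Q(2) sum.spherical_polytope_cone_polytope Q(1) obtain f g where fg:
      "\<And>X. X \<in> spherical_faces sum.cone_polytope \<Longrightarrow> f X \<in> spherical_faces Q"
      "\<And>X Y. X \<in> spherical_faces sum.cone_polytope \<Longrightarrow> Y \<in> spherical_faces sum.cone_polytope
        \<Longrightarrow> f X \<subseteq> f Y \<longleftrightarrow> X \<subseteq> Y"
      "\<And>X. X \<in> spherical_faces sum.cone_polytope \<Longrightarrow> dim (f X) = dim X"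
      "\<And>p. {p} \<in> spherical_faces sum.cone_polytope \<Longrightarrow> {g p} \<in> spherical_faces Q"
      "\<And>p X. {p} \<in> spherical_faces sum.cone_polytope \<Longrightarrow> X \<in> spherical_faces sum.cone_polytope
        \<Longrightarrow> g p \<in> f X \<longleftrightarrow> p \<in> X"
      by (rule combinatorially_equivalent_verticesE) blast
    have inj: "inj_on g gens"
    proof (rule inj_onI)
      fix p q assume "p \<in> gens" "q \<in> gens" "g p = g q"
      then show "p = q"
        using fg(5)[OF gens_vertex[of p] gens_vertex[of q]] fg(5)[OF gens_vertex[of q] gens_vertex[of q]]
        by simp
    qed
    define h where "h = inv_into gens g"
    have hg: "h (g p) = p" if "p \<in> gens" for p using that inj by (simp add: h_def)
    show False
    proof (rule not_weakly_1_scribed[OF Q(1,3), of "g ` gens" "\<lambda>v w. f (edge (h v) (h w))"])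
      show "finite (g ` gens)" using card_gens by simp
      show "DIM(real \<times> (real^'n)) < card (g ` gens)" using card_gens inj by (simp add: card_image)
      show "g ` gens \<subseteq> Q"
        using fg(4)[OF gens_vertex] spherical_face_subset[OF Q(1)] by blast
      fix v w assume "v \<in> g ` gens" "w \<in> g ` gens" "v \<noteq> w"
      then obtain p q where pq: "p \<in> gens" "q \<in> gens" "p \<noteq> q" "v = g p" "w = g q" by blast
      show "f (edge (h v) (h w)) \<in> spherical_faces Q" by (intro fg edge_face)
      show "dim (f (edge (h v) (h w))) = 2"
        using fg(3)[OF edge_face] edge_props(1) pq hg by simp
      have "g r \<in> f (edge p q) \<longleftrightarrow> r \<in> {p, q}" if "r \<in> gens" for r
        using fg(5)[OF gens_vertex[OF that] edge_face] edge_props(2)[OF pq(1-3)] that by blast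
      then show "f (edge (h v) (h w)) \<inter> g ` gens = {v, w}"
        unfolding pq(4,5) hg[OF pq(1)] hg[OF pq(2)] using pq(1,2) by blast
    qed
  qed
qed

lemma not_weakly_scribable_ge_2:
  assumes "3 \<le> CARD('n::finite)" "2 \<le> k" "k < CARD('n)"
  shows "\<exists>P :: (real \<times> (real^'n)) set. spherical_d_polytope CARD('n) P \<and> \<not> weakly_scribable k P"
proof -
  have "4 \<le> DIM(real \<times> (real^'n))" using assms by simp
  then obtain \<tau> \<xi> \<eta> \<zeta> :: "real \<times> (real^'n)"
    where "four_axes \<tau> \<xi> \<eta> \<zeta> (Basis - {\<tau>, \<xi>, \<eta>, \<zeta>})"
    by (rule four_axes_exist)
  then interpret four_axes \<tau> \<xi> \<eta> \<zeta> "Basis - {\<tau>, \<xi>, \<eta>, \<zeta>}" .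
  have "card (Basis - {\<tau>, \<xi>, \<eta>, \<zeta>}) = Suc CARD('n) - card {\<tau>, \<xi>, \<eta>, \<zeta>}"
    using Basis by (subst card_Diff_subset) auto
  \<comment> \<open>There are \<open>d - 3\<close> axes besides the four, and \<open>k < d\<close>
    leaves room for \<open>k - 2\<close> apexes among them.\<close>
  then have "k - 2 \<le> card (Basis - {\<tau>, \<xi>, \<eta>, \<zeta>})"
    using distinct assms by simp
  then obtain S where S: "S \<subseteq> Basis - {\<tau>, \<xi>, \<eta>, \<zeta>}" "card S = k - 2"
    by (rule obtain_subset_with_card_n)
  show ?thesis
  proof (intro exI conjI notI)
    show "spherical_d_polytope CARD('n) dual.cone_polytope"
      by (rule dual.spherical_d_polytope_cone_polytope) simp
    assume "weakly_scribable k dual.cone_polytope"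
    then obtain Q :: "(real \<times> (real^'n)) set" where Q: "spherical_polytope Q" 
      "combinatorially_equivalent dual.cone_polytope Q" "weakly_scribed k Q"
      by (auto simp: weakly_scribable_def spherical_d_polytope_def)
    from Q(2) dual.spherical_polytope_cone_polytope Q(1) obtain f g where fg:
      "\<And>X. X \<in> spherical_faces dual.cone_polytope \<Longrightarrow> f X \<in> spherical_faces Q"
      "\<And>X Y. X \<in> spherical_faces dual.cone_polytope \<Longrightarrow> Y \<in> spherical_faces dual.cone_polytope
        \<Longrightarrow> f X \<subseteq> f Y \<longleftrightarrow> X \<subseteq> Y"
      "\<And>X. X \<in> spherical_faces dual.cone_polytope \<Longrightarrow> dim (f X) = dim X"
      "\<And>p. {p} \<in> spherical_faces dual.cone_polytope \<Longrightarrow> {g p} \<in> spherical_faces Q"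
      "\<And>p X. {p} \<in> spherical_faces dual.cone_polytope \<Longrightarrow> X \<in> spherical_faces dual.cone_polytope
        \<Longrightarrow> g p \<in> f X \<longleftrightarrow> p \<in> X"
      by (rule combinatorially_equivalent_verticesE) blast
    note df = dual_faces[OF S(1)]
    show False
    proof (rule not_weakly_k_scribed[OF Q(1,3), of "f (pyr S)" "f (apx S)" "\<lambda>p. f (side S p)"
          "\<lambda>m. g (sgn (nrm m))"])
      show "f (pyr S) \<in> spherical_faces Q" "f (apx S) \<in> spherical_faces Q"
        "f (side S p) \<in> spherical_faces Q" for p by (intro fg df)+
      show "dim (f (pyr S)) = k + 2" "k \<le> dim (f (apx S)) + 2" "dim (f (side S p)) = k + 1" for p
        using fg(3)[OF df(1)] fg(3)[OF df(2)] fg(3)[OF df(3)] dim_pyr[OF S(1)] dim_apx[OF S(1)]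
          dim_side[OF S(1)] S(2) assms(2) by auto
      show "f (apx S) \<subseteq> f (pyr S)" "f (apx S) \<subseteq> f (side S p)" "f (side S p) \<subseteq> f (pyr S)" for p
        using fg(2) df dual_faces_subset[OF S(1)] by blast+
      show "g (sgn (nrm m)) \<in> f (pyr S)" if "m < 6" for m
        using fg(5)[OF nrm_vertex[OF that] df(1)] nrm_pyr[OF S(1)] by blast
      show "g (sgn (nrm m)) \<in> f (side S p) \<longleftrightarrow> incident m p" if "m < 6" for m p
        using fg(5)[OF nrm_vertex[OF that] df(3)] nrm_side[OF S(1) that] by blast
    qed
  qed
qed

theorem theorem4:
  fixes d k :: nat
  assumes "CARD('n::finite) = d" and "3 \<le> d" and "k \<le> d - 1" and "(d, k) \<noteq> (3, 1)"
  shows "\<exists>P :: (real \<times> (real^'n)) set. spherical_d_polytope d P \<and> \<not> weakly_scribable k P"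
proof -
  consider "k = 0" | "k = 1" "4 \<le> d" | "2 \<le> k" "k < d" using assms by fastforce
  then show ?thesis
  proof cases
    case 1
    then show ?thesis using not_weakly_scribable_0[where 'n='n] assms by simp
  next
    case 2
    then show ?thesis using not_weakly_scribable_1[where 'n='n] assms by simp
  next
    case 3
    then show ?thesis using not_weakly_scribable_ge_2[where 'n='n, of k] assms by simp
  qed
qed

end
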